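(* Let $f(z)=\sum_{n=0}^{\infty}a_nz^n$ be analytic in $\mathbb{D}=\{z\in\mathbb{C}:|z|<1\}$ with $|f(z)|\le 1$ for all $z\in\mathbb{D}$. Then $$|a_0|^2+\sum_{n=1}^{\infty}|a_n|r^n+\left(\frac{1}{1+|a_0|}+\frac{r}{1-r}\right)\sum_{n=1}^{\infty}|a_n|^2r^{2n}+\frac{9}{8}\left(\frac{S_r}{\pi-S_r}\right)+\lambda\left(\frac{S_r}{\pi-S_r}\right)^2\le 1\quad\text{for } r\le\frac{1}{3-|a_0|},$$ where $\lambda=\dfrac{P(\gamma)}{8(3-\gamma)^3(1+\gamma)^2(1-7\gamma+4\gamma^2)}=10.787939\ldots$ with $$P(\gamma)=-13581+22491\gamma-14085\gamma^2-2584\gamma^3+8565\gamma^4-5130\gamma^5+903\gamma^6+636\gamma^7-324\gamma^8+40\gamma^9,$$ and $\gamma\approx 0.571317$ is the unique root in the interval $(0,1)$ of the equation $$55647-212544t+296244t^2-200754t^3+61377t^4+5198t^5-10420t^6+972t^7+960t^8+408t^9-420t^{10}+100t^{11}-8t^{12}=0.$$ The equality is achieved for the function $f_a(z)=\frac{a-z}{1-az}$.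
   Context: For $f(z)=\sum_{n=0}^\infty a_nz^n$ analytic in $\mathbb{D}$ and $0<r<1$, $S_r=S_r(f)=\int_{|w|<r}|f'(w)|^2\,dA(w)=\pi\sum_{n=1}^{\infty}n|a_n|^2r^{2n}$, where $dA$ is planar Lebesgue measure. The functions $f_a(z)=\frac{a-z}{1-az}$, $z\in\mathbb{D}$, are taken with parameter $a\in(0,1)$.
   Formalization: The printed value λ = 10.787939… is wrong: the stated formula at the exact root γ gives λ ≈ 10.787923, so only 10.7879 ≤ λ < 10.7880 is claimed. Equality for f_a is stated for a = γ and r = 1/(3−γ), since with this fixed λ it fails for other a. *)

theory Defs
  imports "HOL-Complex_Analysis.Complex_Analysis"
begin

definition power_series_on_disc :: "(nat \<Rightarrow> complex) \<Rightarrow> (complex \<Rightarrow> complex) \<Rightarrow> bool" where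
  "power_series_on_disc a f \<longleftrightarrow> (\<forall>z\<in>ball 0 1. (\<lambda>n. a n * z ^ n) sums f z)"

text \<open>The area of the image of the disc of radius \<open>r\<close>, counted with multiplicity;
  \<open>lborel\<close> on the type of complex numbers is planar Lebesgue measure.\<close>

definition S_area :: "(complex \<Rightarrow> complex) \<Rightarrow> real \<Rightarrow> real" where
  "S_area f r = (LINT w:ball 0 r|lborel. (cmod (deriv f w))\<^sup>2)"

definition gamma_poly :: "real \<Rightarrow> real" where
  "gamma_poly t = 55647 - 212544 * t + 296244 * t^2 - 200754 * t^3 + 61377 * t^4
     + 5198 * t^5 - 10420 * t^6 + 972 * t^7 + 960 * t^8 + 408 * t^9
     - 420 * t^10 + 100 * t^11 - 8 * t^12"

text \<open>Existence and uniqueness of this root are part of the main theorem.\<close>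

definition gamma_root :: real where
  "gamma_root = (THE t. 0 < t \<and> t < 1 \<and> gamma_poly t = 0)"

definition P_poly :: "real \<Rightarrow> real" where
  "P_poly t = - 13581 + 22491 * t - 14085 * t^2 - 2584 * t^3 + 8565 * t^4
     - 5130 * t^5 + 903 * t^6 + 636 * t^7 - 324 * t^8 + 40 * t^9"

definition lambda_const :: real where
  "lambda_const = P_poly gamma_root /
     (8 * (3 - gamma_root)^3 * (1 + gamma_root)^2 * (1 - 7 * gamma_root + 4 * gamma_root^2))"

text \<open>The sums over \<open>n \<ge> 1\<close> are written as sums over all \<open>n\<close> with index \<open>Suc n\<close>.\<close>

definition bohr_lhs :: "(nat \<Rightarrow> complex) \<Rightarrow> (complex \<Rightarrow> complex) \<Rightarrow> real \<Rightarrow> real" where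
  "bohr_lhs a f r =
     (cmod (a 0))\<^sup>2
     + (\<Sum>n. cmod (a (Suc n)) * r ^ Suc n)
     + (1 / (1 + cmod (a 0)) + r / (1 - r)) * (\<Sum>n. (cmod (a (Suc n)))\<^sup>2 * r ^ (2 * Suc n))
     + 9 / 8 * (S_area f r / (pi - S_area f r))
     + lambda_const * (S_area f r / (pi - S_area f r))\<^sup>2"

definition disc_aut :: "real \<Rightarrow> complex \<Rightarrow> complex" where
  "disc_aut a z = (of_real a - z) / (1 - of_real a * z)"

end

theory Submission
  imports Defs
begin

text \<open>Multiplication by a function bounded by 1 is a contraction on truncated coefficient vectors.
  Testing this contraction on suitable vectors gives Carlson's coefficient inequalities, which sum up
  to the refined Bohr inequality: the middle terms are at most \<open>(1 - |a\<^sub>0|\<^sup>2) r / (1 - r)\<close>. Applied to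
  the Schwarz function of \<open>f\<close> it gives Rogosinski's inequality, hence (the weights \<open>n r\<^sup>2\<^sup>n\<close> being
  decreasing for \<open>r\<^sup>2 \<le> 1/2\<close>) \<open>S\<^sub>r \<le> \<pi> r\<^sup>2 (1 - |a\<^sub>0|\<^sup>2)\<^sup>2 / (1 - |a\<^sub>0|\<^sup>2 r\<^sup>2)\<^sup>2\<close>. Both bounds are attained by
  \<open>f\<^sub>a\<close> with \<open>a = |a\<^sub>0|\<close> and increase with \<open>r\<close>, so only \<open>f\<^sub>a\<close> at \<open>r = 1 / (3 - a)\<close> matters. What remains
  is that a rational function of \<open>a\<close> is minimal at \<open>\<gamma>\<close>, with minimum \<open>\<lambda>\<close>; the sign of its derivative
  is opposite to that of the polynomial defining \<open>\<gamma>\<close>.\<close>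

section \<open>The constants\<close>

text \<open>At \<open>r = 1 / (3 - a)\<close> one has \<open>r / (1 - r) = 1 / (2 - a)\<close>, so
  the refined Bohr bound leaves the slack \<open>(1 - a\<^sup>2) * (1 - a) / (2 - a)\<close> for the
  two area terms. As \<open>a\<close> tends to 1 this slack behaves like
  \<open>2 * (1 - a)\<^sup>2\<close> and the area quotient of \<open>f\<^sub>a\<close> like
  \<open>16/9 * (1 - a)\<^sup>2\<close>. Hence 9/8 is the largest possible linear coefficient. What
  it leaves has order \<open>(1 - a)^3\<close>, the squared quotient has order
  \<open>(1 - a)^4\<close>, so the admissible quadratic coefficient blows up near 1. The factor
  \<open>1 / (1 + |a\<^sub>0|) + r / (1 - r)\<close> is what Carlson's inequalities produce:
  \<open>|a\<^sub>k|\<^sup>2\<close> enters with weight \<open>1 / (1 + |a\<^sub>0|)\<close> at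
  index \<open>2 * k\<close> and with weight 1 at every larger index. The contraction is obtained
  from finite sums: a dilate of \<open>f\<close> is cut to a polynomial and evaluated at roots of
  unity, where Parseval is an exact finite identity. For the area, rotation invariance of planar
  measure gives the orthogonality of monomials.\<close>

lemma gamma_poly_deriv:
  "(gamma_poly has_real_derivative
     (- 212544 + 592488 * t - 602262 * t^2 + 245508 * t^3 + 25990 * t^4 - 62520 * t^5
      + 6804 * t^6 + 7680 * t^7 + 3672 * t^8 - 4200 * t^9 + 1100 * t^10 - 96 * t^11)) (at t)"
  unfolding gamma_poly_def by (auto intro!: derivative_eq_intros)

text \<open>The polynomial increases again near 1 (its derivative there is 1620), hence the
  restriction to \<open>[0, 3/5]\<close>; \<open>gamma_poly_neg\<close> covers the rest. For
  \<open>t \<le> 3/5\<close> the positive terms of the derivative above degree 3 are absorbed into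
  \<open>t^3\<close> and the negative ones are dropped, which leaves a cubic.\<close>

lemma gamma_poly_strict_decreasing:
  assumes "0 \<le> x" "x < y" "y \<le> 3/5"
  shows "gamma_poly y < gamma_poly x"
proof (rule DERIV_neg_imp_decreasing[OF assms(2)])
  fix t :: real
  assume t: "x \<le> t" "t \<le> y"
  have t0: "0 \<le> t" and t1: "t \<le> 3/5" using t assms by auto
  let ?c = "- 212544 + 592488 * t - 602262 * t^2 + 263884 * t^3"
  have pw: "t^(3 + k) \<le> (3/5)^k * t^3" for k
    using mult_right_mono[OF power_mono[OF t1 t0, of k], of "t^3"] t0
    by (simp add: power_add mult.commute)
  have "t^4 \<le> (3/5) * t^3" "t^6 \<le> (3/5)^3 * t^3" "t^7 \<le> (3/5)^4 * t^3"
    "t^8 \<le> (3/5)^5 * t^3" "t^10 \<le> (3/5)^7 * t^3"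
    using pw[of 1] pw[of 3] pw[of 4] pw[of 5] pw[of 7] by simp_all
  then have "t^4 \<le> (3/5) * t^3" "t^6 \<le> 27/125 * t^3" "t^7 \<le> 81/625 * t^3"
    "t^8 \<le> 243/3125 * t^3" "t^10 \<le> 2187/78125 * t^3"
    by (simp_all add: power_divide)
  moreover have "0 \<le> t^3" "0 \<le> t^5" "0 \<le> t^9" "0 \<le> t^11" using t0 by auto
  ultimately have "- 212544 + 592488 * t - 602262 * t^2 + 245508 * t^3 + 25990 * t^4 - 62520 * t^5
      + 6804 * t^6 + 7680 * t^7 + 3672 * t^8 - 4200 * t^9 + 1100 * t^10 - 96 * t^11 \<le> ?c"
    by linarith
  also have "?c < 0"
  proof -
    \<comment> \<open>Division of \<open>?c\<close> by \<open>t - 3/5\<close>: the remainder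
      \<open>- 2108322/125\<close> is the value at 3/5, and the quotient is positive everywhere by
      completing the square.\<close>
    have "263884 * t^2 - 2219658/5 * t + 8153226/25
        = 263884 * (t - 2219658/5 / 527768)^2 + (8153226/25 - (2219658/5)^2 / (4 * 263884))"
      by (simp add: power2_eq_square field_simps)
    also have "\<dots> > 0" by (intro add_nonneg_pos) (auto simp: power2_eq_square)
    finally have "0 \<le> (3/5 - t) * (263884 * t^2 - 2219658/5 * t + 8153226/25)"
      using t1 by simp
    moreover have "?c = - (3/5 - t) * (263884 * t^2 - 2219658/5 * t + 8153226/25) - 2108322/125"
      by (simp add: power2_eq_square power3_eq_cube field_simps)
    ultimately show ?thesis by linarith
  qed
  finally show "\<exists>D. (gamma_poly has_real_derivative D) (at t) \<and> D < 0"
    using gamma_poly_deriv by blast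
qed

text \<open>In \<open>s = 1 - t\<close> the constant term is -3240, and for
  \<open>s \<le> 2/5\<close> the terms with positive coefficients add up to less than 3236, so
  bounding them one by one just suffices.\<close>

lemma gamma_poly_neg:
  assumes "3/5 \<le> t" "t \<le> 1"
  shows "gamma_poly t < 0"
proof -
  define s where "s = 1 - t"
  have s: "0 \<le> s" "s \<le> 2/5" using assms by (auto simp: s_def)
  have "gamma_poly t = - 3240 - 1620 * s + 5976 * s^2 + 25274 * s^3 + 24535 * s^4 - 2282 * s^5
      + 8144 * s^6 + 396 * s^7 - 1728 * s^8 + 52 * s^9 + 152 * s^10 - 4 * s^11 - 8 * s^12"
  proof -
    have "t = 1 - s" by (simp add: s_def)
    show ?thesis unfolding gamma_poly_def \<open>t = 1 - s\<close> by algebra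
  qed
  moreover have "s^2 \<le> (2/5)^2" "s^3 \<le> (2/5)^3" "s^4 \<le> (2/5)^4" "s^6 \<le> (2/5)^6"
    "s^7 \<le> (2/5)^7" "s^9 \<le> (2/5)^9" "s^10 \<le> (2/5)^10"
    using power_mono[OF s(2,1)] by blast+
  then have "s^2 \<le> 4/25" "s^3 \<le> 8/125" "s^4 \<le> 16/625" "s^6 \<le> 64/15625"
    "s^7 \<le> 128/78125" "s^9 \<le> 512/1953125" "s^10 \<le> 1024/9765625"
    by (simp_all add: power_divide)
  moreover have "0 \<le> s^5" "0 \<le> s^8" "0 \<le> s^11" "0 \<le> s^12" using s by auto
  ultimately show ?thesis using s by linarith
qed

lemma gamma_poly_homogeneous:
  assumes "q \<noteq> 0"
  shows "gamma_poly (p / q) * q^12 =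
     55647 * q^12 - 212544 * p^1 * q^11 + 296244 * p^2 * q^10 - 200754 * p^3 * q^9
      + 61377 * p^4 * q^8 + 5198 * p^5 * q^7 - 10420 * p^6 * q^6 + 972 * p^7 * q^5
      + 960 * p^8 * q^4 + 408 * p^9 * q^3 - 420 * p^10 * q^2 + 100 * p^11 * q^1
      - 8 * p^12"
proof -
  define t where "t = p / q"
  then have p: "p = t * q" using assms by simp
  have "gamma_poly t * q^12 =
     55647 * q^12 - 212544 * p^1 * q^11 + 296244 * p^2 * q^10 - 200754 * p^3 * q^9
      + 61377 * p^4 * q^8 + 5198 * p^5 * q^7 - 10420 * p^6 * q^6 + 972 * p^7 * q^5
      + 960 * p^8 * q^4 + 408 * p^9 * q^3 - 420 * p^10 * q^2 + 100 * p^11 * q^1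
      - 8 * p^12"
    unfolding p gamma_poly_def
    by (simp add: ring_distribs power_mult_distrib mult.assoc mult.left_commute flip: power_add) algebra
  then show ?thesis unfolding t_def .
qed

text \<open>\<open>3669/6422\<close> and \<open>2936/5139\<close> are Stern--Brocot neighbours enclosing the root; small denominators
  keep the integers in the homogenised polynomial manageable for the simplifier.\<close>

lemma gamma_poly_bracket:
  "gamma_poly (3669/6422) > 0" "gamma_poly (2936/5139) < 0"
proof -
  have "0 < gamma_poly (3669/6422) * 6422^12"
    by (subst gamma_poly_homogeneous) simp_all
  then show "gamma_poly (3669/6422) > 0" by (simp only: zero_less_mult_iff) simp
  have "gamma_poly (2936/5139) * 5139^12 < 0"
    by (subst gamma_poly_homogeneous) simp_all
  then show "gamma_poly (2936/5139) < 0" by (simp only: mult_less_0_iff) simp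
qed

lemma gamma_poly_continuous_on: "continuous_on S gamma_poly"
  by (intro continuous_at_imp_continuous_on ballI) (rule DERIV_isCont[OF gamma_poly_deriv])

lemma gamma_poly_zero_unique:
  assumes "0 < t" "t < 1" "gamma_poly t = 0" "0 < u" "u < 1" "gamma_poly u = 0"
  shows "t = u"
proof -
  have le: "v \<le> 3/5" if "v < 1" "gamma_poly v = 0" for v
    by (rule ccontr) (use gamma_poly_neg[of v] that in simp)
  have "\<not> v < w" if "0 < v" "gamma_poly v = 0" "gamma_poly w = 0" "w \<le> 3/5" for v w
    using gamma_poly_strict_decreasing[of v w] that by force
  then have "\<not> t < u" "\<not> u < t" using assms le by blast+
  then show ?thesis by simp
qed

lemma gamma_root_ex1: "\<exists>!t::real. 0 < t \<and> t < 1 \<and> gamma_poly t = 0"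
proof -
  define l u :: real where "l = 3669/6422" and "u = 2936/5139"
  have lu: "0 < l" "l \<le> u" "u < 1" by (simp_all add: l_def u_def)
  have "\<exists>t\<ge>l. t \<le> u \<and> gamma_poly t = 0"
    by (rule IVT2'[OF _ _ \<open>l \<le> u\<close> gamma_poly_continuous_on])
      (use gamma_poly_bracket[folded l_def u_def] in linarith)+
  then obtain t where "l \<le> t" "t \<le> u" "gamma_poly t = 0" by blast
  then have "0 < t \<and> t < 1 \<and> gamma_poly t = 0" using lu by linarith
  then show ?thesis using gamma_poly_zero_unique by blast
qed

lemma gamma_root: "0 < gamma_root" "gamma_root < 1" "gamma_poly gamma_root = 0"
  using theI'[OF gamma_root_ex1] unfolding gamma_root_def by auto

lemma gamma_root_bounds: "3669/6422 < gamma_root" "gamma_root < 2936/5139"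
proof -
  define l u :: real where "l = 3669/6422" and "u = 2936/5139"
  have lu: "0 < l" "l < u" "u < 3/5" by (simp_all add: l_def u_def)
  note b = gamma_poly_bracket[folded l_def u_def]
  have le: "gamma_root \<le> 3/5" using gamma_poly_neg[of gamma_root] gamma_root by linarith
  have "l < gamma_root"
  proof (rule ccontr)
    assume *: "\<not> l < gamma_root"
    then have "gamma_root \<noteq> l" using b gamma_root by auto
    then show False
      using * b lu gamma_root gamma_poly_strict_decreasing[of gamma_root l] by linarith
  qed
  moreover have "gamma_root < u"
  proof (rule ccontr)
    assume *: "\<not> gamma_root < u"
    then have "gamma_root \<noteq> u" using b gamma_root by auto
    then show False
      using * b lu le gamma_root gamma_poly_strict_decreasing[of u gamma_root] by linarith
  qed
  ultimately show "3669/6422 < gamma_root" "gamma_root < 2936/5139"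
    by (simp_all only: l_def u_def)
qed

lemma gamma_poly_pos: "0 \<le> t \<Longrightarrow> t < gamma_root \<Longrightarrow> 0 < gamma_poly t"
  using gamma_poly_strict_decreasing[of t gamma_root] gamma_root gamma_root_bounds by linarith

lemma gamma_poly_neg_right: "gamma_root < t \<Longrightarrow> t \<le> 1 \<Longrightarrow> gamma_poly t < 0"
  using gamma_poly_strict_decreasing[of gamma_root t] gamma_root gamma_poly_neg[of t] by linarith

text \<open>The quartic factor is what remains of
  \<open>8 * (4 - t) * E - 9 * (1 + t) * (3 - t)^2\<close>, where
  \<open>E = (3 - t)^2 - t^4\<close>, after division by \<open>1 - t\<close>; see
  \<open>ratio_eq_slack\<close>.\<close>

definition ratio_num :: "real \<Rightarrow> real" where
  "ratio_num t = (2 - t) * (4 - t) * ((3 - t)^2 - t^4)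
     * (207 - 84 * t + 41 * t^2 + 24 * t^3 - 8 * t^4)"

definition ratio_den :: "real \<Rightarrow> real" where
  "ratio_den t = (1 - t) * (1 + t)^3 * (3 - t)^4"

text \<open>For \<open>f\<^sub>a\<close> at \<open>r = 1 / (3 - a)\<close> the inequality is an equality exactly when its last
  coefficient is \<open>ratio a\<close> (see \<open>extremal_identity\<close>), so the best constant is the minimum of
  \<open>ratio\<close> on \<open>[0, 1)\<close>.\<close>

definition ratio :: "real \<Rightarrow> real" where
  "ratio t = ratio_num t / (8 * ratio_den t)"

text \<open>Origin of \<open>P_poly\<close>. Together with \<open>ratio_den_deriv\<close> it
  accounts for the quotient defining \<open>lambda_const\<close>; the two factors 2 cancel.\<close>

lemma ratio_num_deriv: "(ratio_num has_real_derivative 2 * P_poly t) (at t)"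
proof -
  have "ratio_num x = 14904 - 27162 * x + 22491 * x^2 - 9390 * x^3 - 1292 * x^4 + 3426 * x^5
      - 1710 * x^6 + 258 * x^7 + 159 * x^8 - 72 * x^9 + 8 * x^10" for x
    unfolding ratio_num_def by algebra
  then have *: "ratio_num = (\<lambda>x. 14904 - 27162 * x + 22491 * x^2 - 9390 * x^3 - 1292 * x^4
      + 3426 * x^5 - 1710 * x^6 + 258 * x^7 + 159 * x^8 - 72 * x^9 + 8 * x^10)"
    by blast
  show ?thesis
    unfolding P_poly_def * by (auto intro!: derivative_eq_intros)
qed

lemma ratio_den_deriv:
  "(ratio_den has_real_derivative 2 * (1 + t)^2 * (3 - t)^3 * (1 - 7 * t + 4 * t^2)) (at t)"
proof -
  have "(ratio_den has_real_derivative
     (- 1) * (1 + t)^3 * (3 - t)^4 + (1 - t) * (3 * (1 + t)^2) * (3 - t)^4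
     + (1 - t) * (1 + t)^3 * (- 4 * (3 - t)^3)) (at t)"
    unfolding ratio_den_def[abs_def]
    by (auto intro!: derivative_eq_intros simp: algebra_simps)
  also have "(- 1) * (1 + t)^3 * (3 - t)^4 + (1 - t) * (3 * (1 + t)^2) * (3 - t)^4
     + (1 - t) * (1 + t)^3 * (- 4 * (3 - t)^3)
     = 2 * (1 + t)^2 * (3 - t)^3 * (1 - 7 * t + 4 * t^2)"
    by algebra
  finally show ?thesis .
qed

text \<open>This is the numerator in the quotient rule for \<open>ratio\<close>, up to a constant.
  \<open>ratio_den\<close> and its derivative share the factor \<open>(1 + t)^2 * (3 - t)^3\<close>;
  removing it leaves \<open>- 2 * gamma_poly t\<close>, which is where the equation of degree 12
  comes from.\<close>

lemma ratio_wronskian: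
  "2 * P_poly t * ratio_den t - ratio_num t * (2 * (1 + t)^2 * (3 - t)^3 * (1 - 7 * t + 4 * t^2))
   = - 2 * (1 + t)^2 * (3 - t)^3 * gamma_poly t"
proof -
  have "P_poly t * ((1 - t) * (1 + t) * (3 - t)) - ratio_num t * (1 - 7 * t + 4 * t^2)
      = - gamma_poly t"
    unfolding P_poly_def ratio_num_def gamma_poly_def by algebra
  moreover have "ratio_den t = (1 + t)^2 * (3 - t)^3 * ((1 - t) * (1 + t) * (3 - t))"
    unfolding ratio_den_def by algebra
  ultimately show ?thesis by algebra
qed

lemma ratio_den_pos: "0 \<le> t \<Longrightarrow> t < 1 \<Longrightarrow> 0 < ratio_den t"
  by (simp add: ratio_den_def)

lemma ratio_deriv:
  assumes "0 \<le> t" "t < 1"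
  shows "(ratio has_real_derivative
    - ((1 + t)^2 * (3 - t)^3 * gamma_poly t) / (4 * (ratio_den t)^2)) (at t)"
proof -
  have D: "ratio_den t \<noteq> 0" using ratio_den_pos[OF assms] by simp
  have "(ratio has_real_derivative
    (2 * P_poly t * (8 * ratio_den t)
      - ratio_num t * (8 * (2 * (1 + t)^2 * (3 - t)^3 * (1 - 7 * t + 4 * t^2))))
      / ((8 * ratio_den t) * (8 * ratio_den t))) (at t)"
    unfolding ratio_def[abs_def]
    by (rule DERIV_divide[OF ratio_num_deriv DERIV_cmult[OF ratio_den_deriv]]) (use D in simp)
  also have "(2 * P_poly t * (8 * ratio_den t)
      - ratio_num t * (8 * (2 * (1 + t)^2 * (3 - t)^3 * (1 - 7 * t + 4 * t^2))))
      / ((8 * ratio_den t) * (8 * ratio_den t))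
      = (2 * P_poly t * ratio_den t - ratio_num t * (2 * (1 + t)^2 * (3 - t)^3 * (1 - 7 * t + 4 * t^2)))
        / (8 * (ratio_den t)^2)"
    using D by (simp add: divide_simps power2_eq_square)
  also have "\<dots> = - ((1 + t)^2 * (3 - t)^3 * gamma_poly t) / (4 * (ratio_den t)^2)"
    unfolding ratio_wronskian using D by (simp add: divide_simps)
  finally show ?thesis .
qed

lemma gamma_root_quadratic_neg: "1 - 7 * gamma_root + 4 * gamma_root^2 < 0"
proof -
  have "1/2 < gamma_root" using gamma_root_bounds by linarith
  moreover have "gamma_root^2 \<le> gamma_root"
    using gamma_root by (simp add: power2_eq_square)
  ultimately show ?thesis by linarith
qed

text \<open>At a critical point of \<open>ratio\<close> the quotient of numerator and denominator equals the quotient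
  of their derivatives, which is the form in which \<open>lambda_const\<close> is given.\<close>

lemma lambda_const_eq_ratio: "lambda_const = ratio gamma_root"
proof -
  have "2 * P_poly gamma_root * ratio_den gamma_root
     = ratio_num gamma_root * (2 * (1 + gamma_root)^2 * (3 - gamma_root)^3
        * (1 - 7 * gamma_root + 4 * gamma_root^2))"
    using ratio_wronskian[of gamma_root] by (simp add: gamma_root)
  then have *: "P_poly gamma_root * ratio_den gamma_root = ratio_num gamma_root *
      ((3 - gamma_root)^3 * (1 + gamma_root)^2 * (1 - 7 * gamma_root + 4 * gamma_root^2))"
    by algebra
  define X where "X = (3 - gamma_root)^3 * (1 + gamma_root)^2 * (1 - 7 * gamma_root + 4 * gamma_root^2)"
  have nz: "ratio_den gamma_root \<noteq> 0" "X \<noteq> 0"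
    using ratio_den_pos[of gamma_root] gamma_root gamma_root_quadratic_neg by (auto simp: X_def)
  have "lambda_const = P_poly gamma_root / (8 * X)"
    unfolding lambda_const_def X_def by (simp only: mult.assoc)
  also have "\<dots> = ratio gamma_root"
    using * nz unfolding ratio_def X_def[symmetric] by (simp add: frac_eq_eq)
  finally show ?thesis .
qed

lemma lambda_const_le_ratio:
  assumes "0 \<le> t" "t < 1"
  shows "lambda_const \<le> ratio t"
proof (cases "t \<le> gamma_root")
  case True
  then show ?thesis unfolding lambda_const_eq_ratio
  proof (rule DERIV_nonpos_imp_nonincreasing)
    fix x assume x: "t \<le> x" "x \<le> gamma_root"
    then have "0 \<le> x" "x < 1" using assms gamma_root by auto
    moreover have "0 \<le> gamma_poly x"
      using gamma_poly_pos[of x] gamma_root x assms by (cases "x = gamma_root") auto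
    ultimately show "\<exists>y. (ratio has_real_derivative y) (at x) \<and> y \<le> 0"
      using ratio_deriv by (intro exI conjI) (assumption | simp)+
  qed
next
  case False
  then have "gamma_root \<le> t" by simp
  then show ?thesis unfolding lambda_const_eq_ratio
  proof (rule DERIV_nonneg_imp_nondecreasing)
    fix x assume x: "gamma_root \<le> x" "x \<le> t"
    then have *: "0 \<le> x" "x < 1" using assms gamma_root by auto
    moreover have "gamma_poly x \<le> 0"
      using gamma_poly_neg_right[of x] gamma_root x * by (cases "x = gamma_root") auto
    ultimately show "\<exists>y. (ratio has_real_derivative y) (at x) \<and> y \<ge> 0"
      using ratio_deriv[OF *]
      by (intro exI[of _ "- ((1 + x)^2 * (3 - x)^3 * gamma_poly x) / (4 * (ratio_den x)^2)"] conjI)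
        (assumption | simp add: mult_nonneg_nonpos divide_nonpos_nonneg)+
  qed
qed

text \<open>Clearing the denominator \<open>W\<close> leaves inequalities that are linear in the
  powers \<open>g^k\<close>. Each power is enclosed by the powers of the two rational bounds, whose
  distance of about \<open>3e-8\<close> is small enough for linear arithmetic.\<close>

lemma lambda_const_bounds: "10.7879 \<le> lambda_const" "lambda_const < 10.7880"
proof -
  define g where "g = gamma_root"
  have b: "3669 \<le> 6422 * g" "5139 * g \<le> 2936" "0 \<le> g"
    using gamma_root_bounds gamma_root by (auto simp: g_def)
  have lo: "3669^k \<le> 6422^k * g^k" and up: "5139^k * g^k \<le> 2936^k" for k
    using power_mono[OF b(1), of k] power_mono[OF b(2), of k] b(3)
    unfolding power_mult_distrib by auto
  note pows = lo[of 2] lo[of 3] lo[of 4] lo[of 5] lo[of 6] lo[of 7] lo[of 8] lo[of 9]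
    up[of 2] up[of 3] up[of 4] up[of 5] up[of 6] up[of 7] up[of 8] up[of 9]
  define W where "W = 8 * (3 - g)^3 * (1 + g)^2 * (1 - 7 * g + 4 * g^2)"
  have W: "W = 216 - 1296 * g - 792 * g^2 + 1792 * g^3 + 40 * g^4 - 720 * g^5 + 280 * g^6 - 32 * g^7"
    unfolding W_def by algebra
  \<comment> \<open>\<open>W\<close> is negative, so both inequalities are reversed when the
    division is cleared.\<close>
  have "W < 0" "107879 * W \<ge> 10000 * P_poly g" "107880 * W < 10000 * P_poly g"
    using b pows[simplified] unfolding W P_poly_def by (simp_all add: algebra_simps)
  then show "10.7879 \<le> lambda_const" "lambda_const < 10.7880"
    unfolding lambda_const_def g_def[symmetric] W_def[symmetric] by (simp_all add: divide_simps)
qed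

text \<open>The left side is \<open>1 - a\<^sup>2 - (1 - a\<^sup>2) / (2 - a)\<close>, the room left
  by the other terms for \<open>f\<^sub>a\<close> at \<open>r = 1 / (3 - a)\<close>, and
  \<open>Q\<close> is the area quotient there. \<open>ratio\<close> arises by solving this equation
  for the coefficient of \<open>Q^2\<close>.\<close>

lemma ratio_eq_slack:
  assumes "0 \<le> a" "a < 1"
  defines "Q \<equiv> (1 - a^2)^2 * (3 - a)^2 / ((2 - a) * (4 - a) * ((3 - a)^2 - a^4))"
  shows "(1 - a^2) * (1 - a) / (2 - a) = 9 / 8 * Q + ratio a * Q^2"
proof -
  define E where "E = (3 - a)^2 - a^4"
  define H where "H = 207 - 84 * a + 41 * a^2 + 24 * a^3 - 8 * a^4"
  \<comment> \<open>At \<open>a = 1\<close> both terms on the left are 72: this is the cancellation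
    for which 9/8 is chosen.\<close>
  have EH: "8 * (4 - a) * E - 9 * (1 + a) * (3 - a)^2 = (1 - a) * H"
    unfolding E_def H_def by algebra
  have "a^4 \<le> 1" using assms by (simp add: power_le_one)
  moreover have "(3 - a)^2 > 2^2" by (rule power_strict_mono) (use assms in auto)
  ultimately have "E > 0" by (simp add: E_def)
  then have nz: "E \<noteq> 0" "2 - a \<noteq> 0" "4 - a \<noteq> 0" "1 - a \<noteq> 0" "1 + a \<noteq> 0" "3 - a \<noteq> 0"
    using assms by auto
  have sq: "1 - a^2 = (1 - a) * (1 + a)" by algebra
  have "Q = (1 - a)^2 * (1 + a)^2 * (3 - a)^2 / ((2 - a) * (4 - a) * E)"
    unfolding Q_def E_def sq by (simp add: power_mult_distrib)
  moreover have "ratio a = (2 - a) * (4 - a) * E * H / (8 * ((1 - a) * (1 + a)^3 * (3 - a)^4))"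
    unfolding ratio_def ratio_num_def ratio_den_def E_def H_def by simp
  ultimately have "ratio a * Q^2 = (1 - a)^3 * (1 + a) * H / (8 * (2 - a) * (4 - a) * E)"
    using nz by (simp add: divide_simps) algebra
  also have "\<dots> = (1 - a)^2 * (1 + a) * (8 * (4 - a) * E - 9 * (1 + a) * (3 - a)^2)
        / (8 * (2 - a) * (4 - a) * E)"
    unfolding EH by (simp add: power2_eq_square power3_eq_cube)
  also have "\<dots> = (1 - a^2) * (1 - a) / (2 - a) - 9 / 8 * Q"
    unfolding \<open>Q = _\<close> sq using nz by (simp add: divide_simps) algebra
  finally show ?thesis by simp
qed

section \<open>Coefficients of bounded analytic functions\<close>

definition root_of_unity :: "nat \<Rightarrow> nat \<Rightarrow> complex" where
  "root_of_unity M l = exp (2 * of_real pi * \<i> * of_nat l / of_nat M)"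

lemma norm_root_of_unity [simp]: "cmod (root_of_unity M l) = 1"
  by (simp add: root_of_unity_def norm_exp_eq_Re)

lemma root_of_unity_orthogonality:
  assumes "k < M" "j < M"
  shows "(\<Sum>l<M. root_of_unity M l ^ k * cnj (root_of_unity M l ^ j)) = (if k = j then of_nat M else 0)"
proof -
  have M: "M \<ge> 1" using assms by simp
  define u where "u = root_of_unity M k * cnj (root_of_unity M j)"
  \<comment> \<open>This symmetry in \<open>k\<close> and \<open>l\<close> turns the sum over
    \<open>l\<close> into a geometric sum whose ratio \<open>u\<close> is an \<open>M\<close>-th
    root of unity.\<close>
  have pow: "root_of_unity M l ^ k = root_of_unity M k ^ l" for l k
    by (simp add: root_of_unity_def flip: exp_of_nat_mult) (simp add: mult_ac)
  have summand: "root_of_unity M l ^ k * cnj (root_of_unity M l ^ j) = u ^ l" for l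
    by (simp add: u_def power_mult_distrib pow)
  show ?thesis
  proof (cases "k = j")
    case True
    then have "u = 1"
      unfolding u_def by (simp flip: complex_norm_square)
    with True show ?thesis unfolding summand by simp
  next
    case False
    have "u \<noteq> 1"
    proof
      assume "u = 1"
      moreover have "root_of_unity M j * cnj (root_of_unity M j) = 1"
        by (simp flip: complex_norm_square)
      ultimately have "root_of_unity M k = root_of_unity M j"
        unfolding u_def by (metis mult.assoc mult.commute mult_1)
      then have "k mod M = j mod M"
        unfolding root_of_unity_def using complex_root_unity_eq[OF M] by simp
      then show False using assms False by simp
    qed
    moreover have "root_of_unity M l ^ M = 1" for l
    proof -
      have "root_of_unity M l ^ M = exp (2 * of_real pi * \<i> * of_nat l)"
        unfolding root_of_unity_def exp_of_nat_mult[symmetric] using M by simp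
      also have "\<dots> = 1" by (auto simp: exp_eq_1 intro!: exI[of _ "int l"])
      finally show ?thesis .
    qed
    then have "u ^ M = 1" by (simp add: u_def power_mult_distrib flip: complex_cnj_power)
    ultimately show ?thesis
      unfolding summand using False by (simp add: sum_gp_strict geometric_sum)
  qed
qed

lemma poly_eq_sum_lessThan:
  fixes p :: "'a::comm_semiring_1 poly"
  assumes "degree p < M"
  shows "poly p z = (\<Sum>i<M. coeff p i * z ^ i)"
proof -
  have "(\<Sum>i<M. coeff p i * z ^ i) = (\<Sum>i\<le>degree p. coeff p i * z ^ i)"
    by (rule sum.mono_neutral_right) (use assms in \<open>auto simp: coeff_eq_0\<close>)
  then show ?thesis by (simp add: poly_altdef)
qed

lemma discrete_parseval:
  assumes "degree p < M" "degree q < M"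
  shows "(\<Sum>l<M. poly p (root_of_unity M l) * cnj (poly q (root_of_unity M l)))
       = of_nat M * (\<Sum>i<M. coeff p i * cnj (coeff q i))"
proof -
  have "(\<Sum>l<M. poly p (root_of_unity M l) * cnj (poly q (root_of_unity M l)))
     = (\<Sum>l<M. \<Sum>k<M. \<Sum>j<M. (coeff p k * cnj (coeff q j)) *
           (root_of_unity M l ^ k * cnj (root_of_unity M l ^ j)))"
    unfolding poly_eq_sum_lessThan[OF assms(1)] poly_eq_sum_lessThan[OF assms(2)]
    by (simp add: sum_product mult_ac)
  also have "\<dots> = (\<Sum>k<M. \<Sum>j<M. (coeff p k * cnj (coeff q j)) *
           (\<Sum>l<M. root_of_unity M l ^ k * cnj (root_of_unity M l ^ j)))"
  proof -
    let ?h = "\<lambda>l k j. (coeff p k * cnj (coeff q j)) *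
           (root_of_unity M l ^ k * cnj (root_of_unity M l ^ j))"
    have "(\<Sum>l<M. \<Sum>k<M. \<Sum>j<M. ?h l k j) = (\<Sum>k<M. \<Sum>l<M. \<Sum>j<M. ?h l k j)"
      by (rule sum.swap)
    also have "\<dots> = (\<Sum>k<M. \<Sum>j<M. \<Sum>l<M. ?h l k j)"
      by (rule sum.cong[OF refl]) (rule sum.swap)
    finally show ?thesis by (simp only: sum_distrib_left)
  qed
  also have "\<dots> = (\<Sum>k<M. \<Sum>j<M. (coeff p k * cnj (coeff q j)) * (if k = j then of_nat M else 0))"
    by (intro sum.cong refl arg_cong2[of _ _ _ _ "(*)"] root_of_unity_orthogonality) auto
  also have "\<dots> = of_nat M * (\<Sum>i<M. coeff p i * cnj (coeff q i))"
    by (simp add: sum_distrib_left mult_ac if_distrib[of "\<lambda>x. _ * x"] sum.delta cong: if_cong)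
  finally show ?thesis .
qed

lemma discrete_parseval_norm:
  assumes "degree p < M"
  shows "(\<Sum>l<M. (cmod (poly p (root_of_unity M l)))\<^sup>2) = M * (\<Sum>i<M. (cmod (coeff p i))\<^sup>2)"
proof -
  have "complex_of_real (\<Sum>l<M. (cmod (poly p (root_of_unity M l)))\<^sup>2)
      = of_real (M * (\<Sum>i<M. (cmod (coeff p i))\<^sup>2))"
    using discrete_parseval[OF assms assms]
    by (simp add: complex_norm_square del: of_real_power)
  then show ?thesis by (simp only: of_real_eq_iff)
qed

text \<open>\<open>M\<close> exceeds the degree of \<open>F * p\<close>, so no coefficients wrap
  around and the coefficient inner product is an average over the \<open>M\<close>-th roots of
  unity. There the bound on \<open>F\<close> applies pointwise, followed by
  \<open>2 * s * t \<le> s\<^sup>2 + t\<^sup>2\<close>.\<close>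

lemma toeplitz_polynomial:
  fixes F p q :: "complex poly"
  assumes F: "\<And>z. cmod z = 1 \<Longrightarrow> cmod (poly F z) \<le> B"
    and deg: "degree F + degree p < M" "degree q < M"
  shows "Re (\<Sum>i<M. coeff (F * p) i * cnj (coeff q i))
    \<le> B * ((\<Sum>i<M. (cmod (coeff p i))\<^sup>2) + (\<Sum>i<M. (cmod (coeff q i))\<^sup>2)) / 2"
proof -
  have B: "B \<ge> 0" using F[of 1] order_trans[OF norm_ge_zero] by simp
  have M: "M > 0" using deg by simp
  have dFp: "degree (F * p) < M" using degree_mult_le[of F p] deg by linarith
  have dp: "degree p < M" using deg by simp
  let ?z = "root_of_unity M"
  have "M * Re (\<Sum>i<M. coeff (F * p) i * cnj (coeff q i))
      = Re (of_nat M * (\<Sum>i<M. coeff (F * p) i * cnj (coeff q i)))"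
    by simp
  also have "\<dots> = (\<Sum>l<M. Re (poly (F * p) (?z l) * cnj (poly q (?z l))))"
    unfolding discrete_parseval[OF dFp deg(2), symmetric] by (rule Re_sum)
  also have "\<dots> \<le> (\<Sum>l<M. B * ((cmod (poly p (?z l)))\<^sup>2 + (cmod (poly q (?z l)))\<^sup>2) / 2)"
  proof (rule sum_mono)
    fix l
    have "Re (poly (F * p) (?z l) * cnj (poly q (?z l)))
        \<le> cmod (poly F (?z l)) * (cmod (poly p (?z l)) * cmod (poly q (?z l)))"
      using complex_Re_le_cmod[of "poly (F * p) (?z l) * cnj (poly q (?z l))"]
      by (simp add: norm_mult mult.assoc)
    also have "\<dots> \<le> B * (cmod (poly p (?z l)) * cmod (poly q (?z l)))"
      by (rule mult_right_mono) (auto simp: F)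
    also have "\<dots> \<le> B * (((cmod (poly p (?z l)))\<^sup>2 + (cmod (poly q (?z l)))\<^sup>2) / 2)"
      using sum_squares_bound[of "cmod (poly p (?z l))" "cmod (poly q (?z l))"] B
      by (intro mult_left_mono) auto
    finally show "Re (poly (F * p) (?z l) * cnj (poly q (?z l)))
        \<le> B * ((cmod (poly p (?z l)))\<^sup>2 + (cmod (poly q (?z l)))\<^sup>2) / 2" by simp
  qed
  also have "\<dots> = B * ((\<Sum>l<M. (cmod (poly p (?z l)))\<^sup>2) + (\<Sum>l<M. (cmod (poly q (?z l)))\<^sup>2)) / 2"
    by (simp add: sum.distrib flip: sum_distrib_left sum_divide_distrib)
  also have "\<dots> = M * (B * ((\<Sum>i<M. (cmod (coeff p i))\<^sup>2) + (\<Sum>i<M. (cmod (coeff q i))\<^sup>2)) / 2)"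
    unfolding discrete_parseval_norm[OF dp] discrete_parseval_norm[OF deg(2)]
    by (simp add: algebra_simps)
  finally show ?thesis using M by simp
qed

section \<open>Contraction on truncated coefficient vectors\<close>

definition truncation :: "nat \<Rightarrow> (nat \<Rightarrow> complex) \<Rightarrow> complex poly" where
  "truncation K c = Abs_poly (\<lambda>k. if k \<le> K then c k else 0)"

lemma coeff_truncation: "coeff (truncation K c) k = (if k \<le> K then c k else 0)"
proof -
  have "coeff (truncation K c) = (\<lambda>k. if k \<le> K then c k else 0)"
    unfolding truncation_def by (rule coeff_Abs_poly[of K]) simp
  then show ?thesis by simp
qed

lemma degree_truncation: "degree (truncation K c) \<le> K"
  by (rule degree_le) (simp add: coeff_truncation)

lemma poly_truncation: "poly (truncation K c) z = (\<Sum>k\<le>K. c k * z ^ k)"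
proof -
  have "degree (truncation K c) < Suc K" using degree_truncation[of K c] by simp
  from poly_eq_sum_lessThan[OF this] show ?thesis
    by (simp add: lessThan_Suc_atMost coeff_truncation)
qed

lemma power_series_on_disc_abs_summable:
  assumes "power_series_on_disc a f" "0 \<le> \<rho>" "\<rho> < 1"
  shows "summable (\<lambda>n. cmod (a n) * \<rho> ^ n)"
proof -
  obtain s where s: "\<rho> < s" "s < 1" using dense[OF assms(3)] by blast
  have "summable (\<lambda>n. a n * of_real s ^ n)"
    using assms s unfolding power_series_on_disc_def
    by (intro sums_summable[of _ "f (of_real s)"]) auto
  then have "summable (\<lambda>n. norm (a n * of_real \<rho> ^ n))"
    by (rule powser_insidea) (use assms s in auto)
  then show ?thesis using assms by (simp add: norm_mult norm_power)
qed

text \<open>Equivalent to operator norm at most 1 for all lower triangular Toeplitz matrices built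
  from \<open>a\<close>: putting \<open>y\<close> equal to the image of \<open>x\<close> gives the
  norm form. The bilinear form is kept because it can be tested on pairs of vectors, as in
  \<open>toeplitz_corner\<close>.\<close>

definition toeplitz_contractive :: "(nat \<Rightarrow> complex) \<Rightarrow> bool" where
  "toeplitz_contractive a \<longleftrightarrow> (\<forall>N x y.
     Re (\<Sum>i\<le>N. (\<Sum>j\<le>i. a j * x (i - j)) * cnj (y i))
       \<le> ((\<Sum>i\<le>N. (cmod (x i))\<^sup>2) + (\<Sum>i\<le>N. (cmod (y i))\<^sup>2)) / 2)"

text \<open>Dilation by \<open>\<rho> < 1\<close> makes the series converge absolutely on the unit
  circle, so that a long truncation exceeds the bound 1 there by at most \<epsilon>.\<close>

lemma toeplitz_contractive_dilated:
  assumes ps: "power_series_on_disc a f" and bd: "\<And>z. z \<in> ball 0 1 \<Longrightarrow> cmod (f z) \<le> 1"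
    and \<rho>: "0 \<le> \<rho>" "\<rho> < 1" and "0 < \<epsilon>"
  shows "Re (\<Sum>i\<le>N. (\<Sum>j\<le>i. a j * of_real \<rho> ^ j * x (i - j)) * cnj (y i))
       \<le> (1 + \<epsilon>) * ((\<Sum>i\<le>N. (cmod (x i))\<^sup>2) + (\<Sum>i\<le>N. (cmod (y i))\<^sup>2)) / 2"
proof -
  let ?b = "\<lambda>n. cmod (a n) * \<rho> ^ n"
  let ?c = "\<lambda>n. a n * of_real \<rho> ^ n"
  have sm: "summable ?b" by (rule power_series_on_disc_abs_summable[OF ps \<rho>])
  from suminf_exist_split[OF \<open>0 < \<epsilon>\<close> sm] obtain K0 where
    K0: "\<And>n. n \<ge> K0 \<Longrightarrow> norm (\<Sum>i. ?b (i + n)) < \<epsilon>" by blast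
  \<comment> \<open>\<open>K0\<close> controls the tail; \<open>K \<ge> N\<close> ensures that the
    product with \<open>truncation N x\<close> has the coefficients of the full series up to
    \<open>N\<close>.\<close>
  define K where "K = max N K0"
  define F where "F = truncation K ?c"
  have F: "cmod (poly F z) \<le> 1 + \<epsilon>" if z: "cmod z = 1" for z
  proof -
    have "cmod (of_real \<rho> * z) < 1" using \<rho> z by (simp add: norm_mult)
    then have in_disc: "of_real \<rho> * z \<in> ball 0 1" by simp
    then have s: "(\<lambda>n. ?c n * z ^ n) sums f (of_real \<rho> * z)"
      using ps unfolding power_series_on_disc_def
      by (metis (no_types, lifting) ext mult.assoc power_mult_distrib)
    have tail: "summable (\<lambda>n. norm (?c (n + Suc K) * z ^ (n + Suc K)))"
      using summable_ignore_initial_segment[OF sm, of "Suc K"] z \<rho>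
      by (simp add: norm_mult norm_power)
    have "f (of_real \<rho> * z) = (\<Sum>n. ?c (n + Suc K) * z ^ (n + Suc K)) + poly F z"
      using suminf_split_initial_segment[OF sums_summable[OF s], of "Suc K"] sums_unique[OF s]
      by (simp add: F_def poly_truncation lessThan_Suc_atMost)
    then have "poly F z = f (of_real \<rho> * z) - (\<Sum>n. ?c (n + Suc K) * z ^ (n + Suc K))" by simp
    also have "cmod \<dots> \<le> cmod (f (of_real \<rho> * z)) + cmod (\<Sum>n. ?c (n + Suc K) * z ^ (n + Suc K))"
      by (rule norm_triangle_ineq4)
    also have "cmod (\<Sum>n. ?c (n + Suc K) * z ^ (n + Suc K))
        \<le> (\<Sum>n. norm (?c (n + Suc K) * z ^ (n + Suc K)))"
      by (rule summable_norm[OF tail])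
    also have "\<dots> = (\<Sum>n. ?b (n + Suc K))"
      using z \<rho> by (simp add: norm_mult norm_power)
    also have "\<dots> \<le> \<epsilon>" using K0[of "Suc K"] K_def by fastforce
    finally show ?thesis using bd[OF in_disc] by linarith
  qed
  define M where "M = K + N + 1"
  have degs: "degree F + degree (truncation N x) < M" "degree (truncation N y) < M"
    using degree_truncation[of K ?c] degree_truncation[of N x] degree_truncation[of N y]
    by (auto simp: M_def F_def)
  have cut: "(\<Sum>i<M. g i) = (\<Sum>i\<le>N. g i)" if "\<And>i. i > N \<Longrightarrow> g i = 0" for g :: "nat \<Rightarrow> 'b::comm_monoid_add"
    by (rule sum.mono_neutral_right) (use that in \<open>auto simp: M_def\<close>)
  have "(\<Sum>i<M. coeff (F * truncation N x) i * cnj (coeff (truncation N y) i))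
      = (\<Sum>i\<le>N. (\<Sum>j\<le>i. ?c j * x (i - j)) * cnj (y i))"
    by (subst cut) (auto intro!: sum.cong simp: coeff_mult coeff_truncation F_def K_def; linarith)+
  moreover have "(\<Sum>i<M. (cmod (coeff (truncation N x) i))\<^sup>2) = (\<Sum>i\<le>N. (cmod (x i))\<^sup>2)" for x
    by (subst cut) (auto simp: coeff_truncation)
  ultimately show ?thesis
    using toeplitz_polynomial[OF F degs] by simp
qed

text \<open>For fixed \<rho> the left side does not involve \<epsilon>, which therefore tends to 0
  first. The left side is then a polynomial in \<rho>, and \<rho> tends to 1.\<close>

lemma toeplitz_contractiveI:
  assumes ps: "power_series_on_disc a f" and bd: "\<And>z. z \<in> ball 0 1 \<Longrightarrow> cmod (f z) \<le> 1"
  shows "toeplitz_contractive a"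
  unfolding toeplitz_contractive_def
proof (intro allI)
  fix N and x y :: "nat \<Rightarrow> complex"
  let ?S = "((\<Sum>i\<le>N. (cmod (x i))\<^sup>2) + (\<Sum>i\<le>N. (cmod (y i))\<^sup>2)) / 2"
  let ?T = "\<lambda>\<rho>. Re (\<Sum>i\<le>N. (\<Sum>j\<le>i. a j * of_real \<rho> ^ j * x (i - j)) * cnj (y i))"
  have S: "?S \<ge> 0" by (simp add: sum_nonneg)
  have bound: "?T \<rho> \<le> ?S" if "0 \<le> \<rho>" "\<rho> < 1" for \<rho>
  proof (rule field_le_epsilon)
    fix e :: real assume "0 < e"
    \<comment> \<open>\<open>?S\<close> may be 0; adding 1 keeps the chosen \<epsilon>
      positive.\<close>
    have "?T \<rho> \<le> (1 + e / (?S + 1)) * ?S"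
      using toeplitz_contractive_dilated[OF ps bd that, where \<epsilon> = "e / (?S + 1)" and N = N and x = x and y = y] \<open>0 < e\<close> S
      by simp
    also have "\<dots> \<le> ?S + e" using S \<open>0 < e\<close> by (simp add: field_simps)
    finally show "?T \<rho> \<le> ?S + e" .
  qed
  have "((\<lambda>\<rho>. ?T \<rho>) \<longlongrightarrow> ?T 1) (at_left 1)"
    by (intro tendsto_intros)
  moreover have "\<forall>\<^sub>F \<rho> in at_left (1::real). ?T \<rho> \<le> ?S"
    
    using eventually_at_left_real[OF zero_less_one] by (rule eventually_mono) (rule bound, simp_all)
  ultimately have "?T 1 \<le> ?S"
    by (rule tendsto_upperbound) simp
  then show "Re (\<Sum>i\<le>N. (\<Sum>j\<le>i. a j * x (i - j)) * cnj (y i)) \<le> ?S" by simp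
qed

lemma toeplitz_contractive_norm:
  assumes "toeplitz_contractive a"
  shows "(\<Sum>i\<le>N. (cmod (\<Sum>j\<le>i. a j * x (i - j)))\<^sup>2) \<le> (\<Sum>i\<le>N. (cmod (x i))\<^sup>2)"
proof -
  let ?y = "\<lambda>i. \<Sum>j\<le>i. a j * x (i - j)"
  have "(\<Sum>i\<le>N. (cmod (?y i))\<^sup>2) = Re (\<Sum>i\<le>N. ?y i * cnj (?y i))"
    by (simp only: complex_norm_square[symmetric] Re_sum Re_complex_of_real)
  then show ?thesis
    using assms[unfolded toeplitz_contractive_def, rule_format, where N = N and x = x and y = ?y] by simp
qed

text \<open>Test vectors: \<open>x = e\<^sub>0 + e\<close> times the reversed conjugate of \<open>u\<close>, and \<open>y = u + e e\<^sub>N\<close>. Choosing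
  \<open>u\<close> to be an initial segment of \<open>a\<close> makes the two outer terms squares of coefficients.\<close>

lemma toeplitz_corner:
  assumes T: "toeplitz_contractive a" and N: "N > 0" and u: "\<And>i. i \<ge> N \<Longrightarrow> u i = 0"
    and e: "cmod e = 1" "a N = e * of_real (cmod (a N))"
  shows "cmod (a N) + 2 * Re (\<Sum>i<N. a i * cnj (u i))
     + Re (e * (\<Sum>i<N. (\<Sum>j\<le>i. a j * cnj (u (N - (i - j)))) * cnj (u i)))
     \<le> 1 + (\<Sum>i<N. (cmod (u i))\<^sup>2)"
proof -
  define x where "x k = (if k = 0 then 1 else 0) + e * cnj (u (N - k))" for k
  define y where "y i = (if i = N then e else u i)" for i
  have ee: "e * cnj e = 1" using e(1) by (simp add: complex_norm_square[symmetric])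
  \<comment> \<open>\<open>u N = 0\<close> makes the two summands of \<open>x\<close> disjoint, so
    no mixed term enters its norm.\<close>
  have x0: "x 0 = 1" by (simp add: x_def u)
  have "(\<Sum>k\<le>N. (cmod (x k))\<^sup>2) = (cmod (x 0))\<^sup>2 + (\<Sum>k<N. (cmod (x (Suc k)))\<^sup>2)"
    by (simp only: lessThan_Suc_atMost[symmetric] sum.lessThan_Suc_shift)
  also have "(\<Sum>k<N. (cmod (x (Suc k)))\<^sup>2) = (\<Sum>k<N. (cmod (u (N - Suc k)))\<^sup>2)"
    by (simp add: x_def norm_mult e)
  also have "\<dots> = (\<Sum>i<N. (cmod (u i))\<^sup>2)"
    by (rule sum.nat_diff_reindex)
  finally have nx: "(\<Sum>k\<le>N. (cmod (x k))\<^sup>2) = 1 + (\<Sum>i<N. (cmod (u i))\<^sup>2)"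
    by (simp add: x0)
  have ny: "(\<Sum>k\<le>N. (cmod (y k))\<^sup>2) = 1 + (\<Sum>i<N. (cmod (u i))\<^sup>2)"
    by (simp add: lessThan_Suc_atMost[symmetric] y_def e)
  have conv: "(\<Sum>j\<le>i. a j * x (i - j)) = a i + e * (\<Sum>j\<le>i. a j * cnj (u (N - (i - j))))" for i
  proof -
    have "(\<Sum>j\<le>i. a j * x (i - j))
       = (\<Sum>j\<le>i. if j = i then a j else 0) + (\<Sum>j\<le>i. e * (a j * cnj (u (N - (i - j)))))"
      unfolding sum.distrib[symmetric] by (intro sum.cong) (auto simp: x_def algebra_simps)
    then show ?thesis by (simp add: sum_distrib_left)
  qed
  have last: "(\<Sum>j\<le>N. a j * cnj (u (N - (N - j)))) = (\<Sum>j<N. a j * cnj (u j))"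
    by (simp add: lessThan_Suc_atMost[symmetric] u)
  have "(\<Sum>i\<le>N. (\<Sum>j\<le>i. a j * x (i - j)) * cnj (y i))
     = (\<Sum>i<N. (\<Sum>j\<le>i. a j * x (i - j)) * cnj (u i)) + (\<Sum>j\<le>N. a j * x (N - j)) * cnj e"
    by (simp add: lessThan_Suc_atMost[symmetric] y_def)
  also have "(\<Sum>j\<le>N. a j * x (N - j)) * cnj e = a N * cnj e + (\<Sum>j<N. a j * cnj (u j))"
    unfolding conv last using ee by (simp add: algebra_simps)
  also have "a N * cnj e = of_real (cmod (a N))"
    using e(2) ee by (metis mult.assoc mult.commute mult_1)
  also have "(\<Sum>i<N. (\<Sum>j\<le>i. a j * x (i - j)) * cnj (u i)) = (\<Sum>i<N. a i * cnj (u i))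
     + e * (\<Sum>i<N. (\<Sum>j\<le>i. a j * cnj (u (N - (i - j)))) * cnj (u i))"
    unfolding conv distrib_right sum.distrib mult.assoc by (simp only: sum_distrib_left)
  finally have eq: "(\<Sum>i\<le>N. (\<Sum>j\<le>i. a j * x (i - j)) * cnj (y i))
     = (\<Sum>i<N. a i * cnj (u i))
       + e * (\<Sum>i<N. (\<Sum>j\<le>i. a j * cnj (u (N - (i - j)))) * cnj (u i))
       + (of_real (cmod (a N)) + (\<Sum>j<N. a j * cnj (u j)))" .
  show ?thesis
    using T[unfolded toeplitz_contractive_def, rule_format, where N = N and x = x and y = y] unfolding eq nx ny by simp
qed

section \<open>Carlson's coefficient inequalities\<close>

lemma unimodular_factor:
  fixes z :: complex
  obtains e where "cmod e = 1" "z = e * of_real (cmod z)"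
proof (cases "z = 0")
  case True
  with that[of 1] show ?thesis by simp
next
  case False
  with that[of "z / of_real (cmod z)"] show ?thesis by (simp add: norm_divide)
qed

text \<open>With \<open>N = 2 * n + 1\<close> and \<open>u\<close> the segment up to
  \<open>n\<close>, a cross term would need \<open>N - (i - j) \<le> n\<close> and
  \<open>i \<le> n\<close>, which is impossible. So \<open>toeplitz_corner\<close> reads
  \<open>|a\<^sub>N| + 2 * s \<le> 1 + s\<close>, where \<open>s\<close> is the sum of
  squares.\<close>

lemma carlson_odd:
  assumes "toeplitz_contractive a"
  shows "cmod (a (2 * n + 1)) \<le> 1 - (\<Sum>k\<le>n. (cmod (a k))\<^sup>2)"
proof -
  define N where "N = 2 * n + 1"
  define u where "u k = (if k \<le> n then a k else 0)" for k
  obtain e where e: "cmod e = 1" "a N = e * of_real (cmod (a N))"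
    by (rule unimodular_factor)
  have cut: "(\<Sum>i<N. g i) = (\<Sum>i\<le>n. g i)" if "\<And>i. i > n \<Longrightarrow> g i = 0" for g :: "nat \<Rightarrow> 'b::comm_monoid_add"
    by (rule sum.mono_neutral_right) (use that in \<open>auto simp: N_def\<close>)
  have "(\<Sum>i<N. (\<Sum>j\<le>i. a j * cnj (u (N - (i - j)))) * cnj (u i)) = 0"
    by (intro sum.neutral ballI) (auto simp: u_def N_def intro!: sum.neutral)
  moreover have "(\<Sum>i<N. a i * cnj (u i)) = of_real (\<Sum>k\<le>n. (cmod (a k))\<^sup>2)"
    by (subst cut) (auto simp: u_def complex_norm_square simp del: of_real_power)
  moreover have "(\<Sum>i<N. (cmod (u i))\<^sup>2) = (\<Sum>k\<le>n. (cmod (a k))\<^sup>2)"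
    by (subst cut) (auto simp: u_def)
  ultimately show ?thesis
    using toeplitz_corner[OF assms _ _ e, of u] by (simp add: N_def u_def)
qed

text \<open>For \<open>N = 2 * n\<close> only the cross term with \<open>i = n\<close> and
  \<open>j = 0\<close> survives. Estimating it by its modulus leaves the gain \<open>(2 * \<kappa> -
  \<kappa>\<^sup>2 * (1 + |a\<^sub>0|)) * |a\<^sub>n|\<^sup>2\<close>, and
  \<open>\<kappa> = 1 / (1 + |a\<^sub>0|)\<close> maximises it.\<close>

lemma carlson_even:
  assumes "toeplitz_contractive a" "n > 0"
  shows "cmod (a (2 * n)) \<le> 1 - (\<Sum>k<n. (cmod (a k))\<^sup>2) - (cmod (a n))\<^sup>2 / (1 + cmod (a 0))"
proof -
  define N where "N = 2 * n"
  define \<kappa> where "\<kappa> = 1 / (1 + cmod (a 0))"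
  define u where "u k = (if k < n then a k else if k = n then of_real \<kappa> * a n else 0)" for k
  obtain e where e: "cmod e = 1" "a N = e * of_real (cmod (a N))"
    by (rule unimodular_factor)
  have cut: "(\<Sum>i<N. g i) = (\<Sum>i<n. g i) + g n" if "\<And>i. i > n \<Longrightarrow> g i = 0"
    for g :: "nat \<Rightarrow> 'b::comm_monoid_add"
  proof -
    have "(\<Sum>i<N. g i) = (\<Sum>i<Suc n. g i)"
      by (rule sum.mono_neutral_right) (use that assms(2) in \<open>auto simp: N_def\<close>)
    then show ?thesis by simp
  qed
  let ?s = "\<Sum>k<n. (cmod (a k))\<^sup>2"
  have "(\<Sum>i<N. (\<Sum>j\<le>i. a j * cnj (u (N - (i - j)))) * cnj (u i))
      = (\<Sum>j\<le>n. a j * cnj (u (N - (n - j)))) * cnj (u n)"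
  proof -
    have "(\<Sum>i<n. (\<Sum>j\<le>i. a j * cnj (u (N - (i - j)))) * cnj (u i)) = 0"
      by (intro sum.neutral ballI) (auto simp: u_def N_def intro!: sum.neutral)
    then show ?thesis by (subst cut) (auto simp: u_def)
  qed
  also have "(\<Sum>j\<le>n. a j * cnj (u (N - (n - j)))) = a 0 * cnj (u n)"
  proof -
    have "(\<Sum>j\<le>n. a j * cnj (u (N - (n - j)))) = (\<Sum>j\<in>{0}. a j * cnj (u (N - (n - j))))"
      by (rule sum.mono_neutral_right) (auto simp: u_def N_def)
    then show ?thesis by (simp add: N_def)
  qed
  finally have cross: "(\<Sum>i<N. (\<Sum>j\<le>i. a j * cnj (u (N - (i - j)))) * cnj (u i))
      = a 0 * cnj (u n) * cnj (u n)" .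
  have \<kappa>: "\<kappa> > 0" by (simp add: \<kappa>_def add_pos_nonneg)
  have "cmod (e * (a 0 * cnj (u n) * cnj (u n))) = cmod (a 0) * \<kappa>\<^sup>2 * (cmod (a n))\<^sup>2"
    using \<kappa> by (simp add: norm_mult e u_def power2_eq_square)
  then have "Re (e * (a 0 * cnj (u n) * cnj (u n))) \<ge> - (cmod (a 0) * \<kappa>\<^sup>2 * (cmod (a n))\<^sup>2)"
    using abs_Re_le_cmod[of "e * (a 0 * cnj (u n) * cnj (u n))"] by linarith
  moreover have "(\<Sum>i<N. a i * cnj (u i)) = of_real (?s + \<kappa> * (cmod (a n))\<^sup>2)"
    by (subst cut) (auto simp: u_def complex_norm_square mult_ac simp del: of_real_power)
  moreover have "(\<Sum>i<N. (cmod (u i))\<^sup>2) = ?s + \<kappa>\<^sup>2 * (cmod (a n))\<^sup>2"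
    by (subst cut) (auto simp: u_def norm_mult power_mult_distrib)
  ultimately have "cmod (a N) + 2 * (?s + \<kappa> * (cmod (a n))\<^sup>2) - cmod (a 0) * \<kappa>\<^sup>2 * (cmod (a n))\<^sup>2
      \<le> 1 + (?s + \<kappa>\<^sup>2 * (cmod (a n))\<^sup>2)"
    using toeplitz_corner[OF assms(1) _ _ e, of u] assms(2) unfolding cross
    by (simp add: N_def u_def)
  then have "cmod (a N) \<le> 1 - ?s - (2 * \<kappa> - \<kappa>\<^sup>2 * (1 + cmod (a 0))) * (cmod (a n))\<^sup>2"
    by (simp add: algebra_simps)
  also have "2 * \<kappa> - \<kappa>\<^sup>2 * (1 + cmod (a 0)) = \<kappa>"
  proof -
    have "\<kappa> * (1 + cmod (a 0)) = 1" by (simp add: \<kappa>_def add_nonneg_eq_0_iff)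
    then show ?thesis by (simp add: power2_eq_square mult.assoc)
  qed
  finally show ?thesis by (simp add: N_def \<kappa>_def)
qed

text \<open>The weight \<open>c\<close> merges odd and even \<open>m\<close>. It vanishes beyond
  \<open>m / 2\<close>, so the cutoff \<open>K\<close> can be fixed independently of
  \<open>m\<close>, as the exchange of sums in \<open>refined_bohr\<close> requires.\<close>

lemma carlson_combined:
  assumes T: "toeplitz_contractive a" and "0 < m"
  defines "A \<equiv> cmod (a 0)"
  defines "c \<equiv> \<lambda>k. if 2 * k < m then 1 else if 2 * k = m then 1 / (1 + A) else 0"
  shows "cmod (a m) + (\<Sum>k<K. (cmod (a (Suc k)))\<^sup>2 * c (Suc k)) \<le> 1 - A\<^sup>2"
proof -
  let ?g = "\<lambda>k. (cmod (a (Suc k)))\<^sup>2 * c (Suc k)"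
  have g0: "?g k \<ge> 0" for k by (auto simp: c_def A_def)
  define n where "n = m div 2"
  have gz: "?g k = 0" if "k \<ge> n" for k using that by (auto simp: c_def n_def)
  have "(\<Sum>k<K. ?g k) = (\<Sum>k\<in>{..<K} \<inter> {..<n}. ?g k)"
    by (intro sum.mono_neutral_right ballI gz) auto
  also have "\<dots> \<le> (\<Sum>k<n. ?g k)"
    by (rule sum_mono2) (use g0 in auto)
  finally have le: "(\<Sum>k<K. ?g k) \<le> (\<Sum>k<n. ?g k)" .
  have "cmod (a m) + (\<Sum>k<n. ?g k) \<le> 1 - A\<^sup>2"
  proof (cases "even m")
    case False
    then have m: "m = 2 * n + 1" by (simp add: n_def)
    have "(\<Sum>k<n. ?g k) = (\<Sum>k<n. (cmod (a (Suc k)))\<^sup>2)"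
      by (intro sum.cong) (auto simp: c_def m)
    moreover have "(\<Sum>k\<le>n. (cmod (a k))\<^sup>2) = A\<^sup>2 + (\<Sum>k<n. (cmod (a (Suc k)))\<^sup>2)"
      unfolding A_def by (simp only: lessThan_Suc_atMost[symmetric] sum.lessThan_Suc_shift)
    ultimately show ?thesis using carlson_odd[OF T, of n] by (simp add: m)
  next
    case True
    then have m: "m = 2 * n" by (simp add: n_def)
    with \<open>0 < m\<close> obtain n' where n': "n = Suc n'" using gr0_implies_Suc by auto
    have "(\<Sum>k<n. ?g k) = (\<Sum>k<n'. ?g k) + (cmod (a n))\<^sup>2 / (1 + A)"
      by (simp add: n' c_def m)
    also have "(\<Sum>k<n'. ?g k) = (\<Sum>k<n'. (cmod (a (Suc k)))\<^sup>2)"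
      by (intro sum.cong) (auto simp: c_def m n')
    finally have "(\<Sum>k<n. ?g k) = (\<Sum>k<n'. (cmod (a (Suc k)))\<^sup>2) + (cmod (a n))\<^sup>2 / (1 + A)" .
    moreover have "(\<Sum>k<n. (cmod (a k))\<^sup>2) = A\<^sup>2 + (\<Sum>k<n'. (cmod (a (Suc k)))\<^sup>2)"
      unfolding A_def n' by (simp only: sum.lessThan_Suc_shift)
    ultimately show ?thesis using carlson_even[OF T, of n] n' by (simp add: m A_def)
  qed
  with le show ?thesis by linarith
qed

section \<open>From Carlson's inequalities to the refined Bohr inequality\<close>

lemma toeplitz_contractive_coeff_bound:
  assumes "toeplitz_contractive a" "0 < m"
  shows "cmod (a m) \<le> 1 - (cmod (a 0))\<^sup>2"
  using carlson_combined[OF assms, of 0] by simp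

lemma toeplitz_contractive_coeff0_le:
  assumes "toeplitz_contractive a"
  shows "cmod (a 0) \<le> 1"
  using order_trans[OF norm_ge_zero toeplitz_contractive_coeff_bound[OF assms, of 1]]
  by (simp add: power_le_one_iff)

text \<open>For fixed \<open>k\<close> the index \<open>m = 2 * k\<close> contributes
  \<open>r ^ (2 * k) / (1 + A)\<close> and the later ones a geometric tail.\<close>

lemma carlson_weight_sums:
  fixes r A :: real
  assumes "0 \<le> r" "r < 1"
  shows "(\<lambda>m. (if 2 * k < m then 1 else if 2 * k = m then 1 / (1 + A) else 0) * r ^ m)
    sums (r ^ (2 * k) * (1 / (1 + A) + r / (1 - r)))"
proof -
  have "(\<lambda>i. r ^ (2 * k + 1) * r ^ i) sums (r ^ (2 * k + 1) * (1 / (1 - r)))"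
    by (intro sums_mult geometric_sums) (use assms in auto)
  also have "(\<lambda>i. r ^ (2 * k + 1) * r ^ i)
      = (\<lambda>i. if 2 * k < i + (2 * k + 1) then r ^ (i + (2 * k + 1)) else 0)"
    by (auto simp: power_add mult_ac)
  finally have "(\<lambda>m. if 2 * k < m then r ^ m else 0) sums
      (r ^ (2 * k + 1) * (1 / (1 - r)) + (\<Sum>i<2 * k + 1. if 2 * k < i then r ^ i else 0))"
    by (subst (asm) sums_iff_shift)
  also have "(\<Sum>i<2 * k + 1. if 2 * k < i then r ^ i else 0) = 0"
    by (intro sum.neutral) auto
  finally have "(\<lambda>m. if 2 * k < m then r ^ m else 0) sums (r ^ (2 * k + 1) * (1 / (1 - r)))"
    by simp
  from sums_add[OF this sums_single[of "2 * k" "\<lambda>m. r ^ m / (1 + A)"]]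
  have "(\<lambda>m. (if 2 * k < m then r ^ m else 0) + (if m = 2 * k then r ^ m / (1 + A) else 0))
     sums (r ^ (2 * k) * (1 / (1 + A) + r / (1 - r)))"
    by (simp add: algebra_simps)
  then show ?thesis by (rule sums_cong[THEN iffD1, rotated]) auto
qed

lemma summable_coeff_power:
  assumes "toeplitz_contractive a" "0 \<le> r" "r < 1"
  shows "summable (\<lambda>n. cmod (a (Suc n)) * r ^ Suc n)"
    and "summable (\<lambda>n. (cmod (a (Suc n)))\<^sup>2 * r ^ (2 * Suc n))"
proof -
  have geo: "summable (\<lambda>n. r ^ Suc n)"
    using assms by (simp add: summable_geometric summable_Suc_iff)
  have le1: "cmod (a (Suc n)) \<le> 1" for n
    using toeplitz_contractive_coeff_bound[OF assms(1), of "Suc n"]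
    by (smt (verit) zero_le_power2 zero_less_Suc)
  show "summable (\<lambda>n. cmod (a (Suc n)) * r ^ Suc n)"
    by (rule summable_comparison_test[OF _ geo])
      (use le1 assms in \<open>auto simp: mult_left_le_one_le\<close>)
  have "(cmod (a (Suc n)))\<^sup>2 * r ^ (2 * Suc n) \<le> 1 * r ^ Suc n" for n
    using le1[of n] assms by (intro mult_mono power_le_one power_decreasing) auto
  then show "summable (\<lambda>n. (cmod (a (Suc n)))\<^sup>2 * r ^ (2 * Suc n))"
    using assms by (intro summable_comparison_test[OF _ geo] exI[of _ 0]) auto
qed

text \<open>Carlson's inequality for \<open>a\<^sub>m\<close> is multiplied by \<open>r ^ m\<close>
  and summed over \<open>m\<close>. Only finitely many \<open>k\<close> take part in the exchange of
  sums; \<open>K\<close> goes to infinity at the end.\<close>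

lemma refined_bohr:
  assumes T: "toeplitz_contractive a" and r: "0 \<le> r" "r < 1"
  shows "(\<Sum>n. cmod (a (Suc n)) * r ^ Suc n)
    + (1 / (1 + cmod (a 0)) + r / (1 - r)) * (\<Sum>n. (cmod (a (Suc n)))\<^sup>2 * r ^ (2 * Suc n))
    \<le> (1 - (cmod (a 0))\<^sup>2) * (r / (1 - r))"
proof -
  define A where "A = cmod (a 0)"
  define C where "C = 1 / (1 + A) + r / (1 - r)"
  define c where "c m k = (if 2 * k < m then 1 else if 2 * k = m then 1 / (1 + A) else 0)" for m k :: nat
  have geo: "(\<lambda>m. (1 - A\<^sup>2) * r ^ Suc m) sums ((1 - A\<^sup>2) * (r / (1 - r)))"
    using sums_mult[OF geometric_sums[of r], of "(1 - A\<^sup>2) * r"] r by (simp add: mult_ac)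
  let ?b = "\<lambda>k. (cmod (a (Suc k)))\<^sup>2"
  have csums: "(\<lambda>m. c (Suc m) (Suc k) * r ^ Suc m) sums (r ^ (2 * Suc k) * C)" for k
  proof -
    \<comment> \<open>Carlson's inequalities start at \<open>m = 1\<close>; since
      \<open>c 0 (Suc k) = 0\<close>, dropping the term at 0 does not change the sum.\<close>
    have "(\<lambda>m. c m (Suc k) * r ^ m) sums (r ^ (2 * Suc k) * C + c 0 (Suc k) * r ^ 0)"
      using carlson_weight_sums[OF r, of "Suc k" A] by (simp add: c_def C_def)
    then show ?thesis by (subst (asm) sums_Suc_iff[symmetric])
  qed
  have partial: "(\<Sum>n. cmod (a (Suc n)) * r ^ Suc n) + (\<Sum>k<K. C * (?b k * r ^ (2 * Suc k)))
      \<le> (1 - A\<^sup>2) * (r / (1 - r))" for K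
  proof (rule sums_le[OF _ _ geo])
    show "(\<lambda>m. cmod (a (Suc m)) * r ^ Suc m + (\<Sum>k<K. ?b k * (c (Suc m) (Suc k) * r ^ Suc m)))
      sums ((\<Sum>n. cmod (a (Suc n)) * r ^ Suc n) + (\<Sum>k<K. C * (?b k * r ^ (2 * Suc k))))"
    proof (intro sums_add summable_sums summable_coeff_power(1)[OF T r] sums_sum)
      fix k
      show "(\<lambda>m. ?b k * (c (Suc m) (Suc k) * r ^ Suc m)) sums (C * (?b k * r ^ (2 * Suc k)))"
        using sums_mult[OF csums[of k], of "?b k"] by (simp only: mult_ac)
    qed
    fix m
    have "(cmod (a (Suc m)) + (\<Sum>k<K. ?b k * c (Suc m) (Suc k))) * r ^ Suc m
        \<le> (1 - A\<^sup>2) * r ^ Suc m"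
      using carlson_combined[OF T, of "Suc m" K] r unfolding c_def A_def
      by (intro mult_right_mono) auto
    then show "cmod (a (Suc m)) * r ^ Suc m + (\<Sum>k<K. ?b k * (c (Suc m) (Suc k) * r ^ Suc m))
        \<le> (1 - A\<^sup>2) * r ^ Suc m"
      by (simp only: distrib_right sum_distrib_right mult.assoc)
  qed
  have "(\<Sum>k. C * (?b k * r ^ (2 * Suc k)))
      \<le> (1 - A\<^sup>2) * (r / (1 - r)) - (\<Sum>n. cmod (a (Suc n)) * r ^ Suc n)"
    using partial
    by (intro suminf_le_const summable_mult summable_coeff_power(2)[OF T r]) (simp add: algebra_simps)
  then show ?thesis
    unfolding suminf_mult[OF summable_coeff_power(2)[OF T r]] by (simp add: A_def C_def)
qed

section \<open>Rogosinski's inequality and the majorant for the area series\<close>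

lemma power_series_on_disc_has_fps_expansion:
  assumes "power_series_on_disc a f"
  shows "f has_fps_expansion Abs_fps a"
proof -
  have "conv_radius a \<ge> 1"
  proof (rule conv_radius_geI_ex')
    fix r :: real assume "0 < r" "ereal r < 1"
    then have "complex_of_real r \<in> ball 0 1" by simp
    then show "summable (\<lambda>n. a n * of_real r ^ n)"
      using assms sums_summable unfolding power_series_on_disc_def by blast
  qed
  then have "fps_conv_radius (Abs_fps a) > 0"
    by (auto simp: fps_conv_radius_def intro: less_le_trans[of 0 1])
  moreover have "\<forall>\<^sub>F z in nhds 0. z \<in> ball (0::complex) 1"
    by (intro eventually_nhds_in_open) auto
  then have "\<forall>\<^sub>F z in nhds 0. eval_fps (Abs_fps a) z = f z"
  proof eventually_elim
    case (elim z)
    then show ?case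
      using assms unfolding power_series_on_disc_def eval_fps_def
      by (auto dest!: bspec[of _ _ z] simp: sums_iff)
  qed
  ultimately show ?thesis by (simp add: has_fps_expansion_def)
qed

lemma has_fps_expansion_unique_ev:
  fixes F G :: "complex fps"
  assumes "f has_fps_expansion F" "g has_fps_expansion G" "\<forall>\<^sub>F z in nhds 0. g z = f z"
  shows "F = G"
proof (rule fps_ext)
  fix n
  show "fps_nth F n = fps_nth G n"
    using higher_deriv_cong_ev[OF assms(3) refl, of n]
    by (simp add: fps_nth_fps_expansion[OF assms(1)] fps_nth_fps_expansion[OF assms(2)])
qed

lemma holomorphic_on_power_series_on_disc:
  assumes "f holomorphic_on ball 0 1"
  shows "power_series_on_disc (\<lambda>n. (deriv ^^ n) f 0 / fact n) f"
  unfolding power_series_on_disc_def using holomorphic_power_series[OF assms] by auto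

lemma power_series_on_disc_0:
  assumes "power_series_on_disc a f"
  shows "f 0 = a 0"
  using assms[unfolded power_series_on_disc_def, rule_format, of 0] by simp

lemma mobius_identity:
  "(cmod (1 - cnj b * z))\<^sup>2 - (cmod (z - b))\<^sup>2 = (1 - (cmod b)\<^sup>2) * (1 - (cmod z)\<^sup>2)"
  unfolding cmod_power2 by (simp add: power2_eq_square algebra_simps)

lemma mobius_norm_le:
  assumes "cmod b < 1" "cmod z \<le> 1"
  shows "1 - cnj b * z \<noteq> 0" and "cmod ((z - b) / (1 - cnj b * z)) \<le> 1"
proof -
  have "cmod (cnj b * z) < 1"
    using assms mult_left_mono[of "cmod z" 1 "cmod b"] by (simp add: norm_mult)
  then show nz: "1 - cnj b * z \<noteq> 0" by auto
  have "0 \<le> (1 - (cmod b)\<^sup>2) * (1 - (cmod z)\<^sup>2)"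
    using assms by (intro mult_nonneg_nonneg) (simp_all add: power_le_one)
  then have "(cmod (z - b))\<^sup>2 \<le> (cmod (1 - cnj b * z))\<^sup>2"
    unfolding mobius_identity[symmetric] by simp
  then have "cmod (z - b) \<le> cmod (1 - cnj b * z)"
    by (rule power2_le_imp_le) simp
  then show "cmod ((z - b) / (1 - cnj b * z)) \<le> 1"
    using nz by (simp add: norm_divide)
qed

text \<open>With \<open>\<omega> = (f - a\<^sub>0) / (1 - cnj a\<^sub>0 f)\<close>, the coefficients of \<open>f - a\<^sub>0 = \<omega> (1 - cnj a\<^sub>0 f)\<close> up to
  degree \<open>n + 1\<close> involve only those of \<open>1 - cnj a\<^sub>0 f\<close> up to degree \<open>n\<close>, because \<open>\<omega> 0 = 0\<close>; now use
  that multiplication by \<open>\<omega>\<close> is contractive on truncated coefficient vectors.\<close>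

lemma rogosinski_step:
  assumes hol: "f holomorphic_on ball 0 1" and ps: "power_series_on_disc a f"
    and bd: "\<And>z. z \<in> ball 0 1 \<Longrightarrow> cmod (f z) \<le> 1" and A: "cmod (a 0) < 1"
  shows "(\<Sum>k<Suc n. (cmod (a (Suc k)))\<^sup>2)
    \<le> (1 - (cmod (a 0))\<^sup>2)\<^sup>2 + (cmod (a 0))\<^sup>2 * (\<Sum>k<n. (cmod (a (Suc k)))\<^sup>2)"
proof -
  define \<omega> where "\<omega> z = (f z - a 0) / (1 - cnj (a 0) * f z)" for z
  define w where "w n = (deriv ^^ n) \<omega> 0 / fact n" for n
  have "\<omega> holomorphic_on ball 0 1"
    unfolding \<omega>_def by (intro holomorphic_intros hol) (use mobius_norm_le(1)[OF A bd] in auto)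
  from holomorphic_on_power_series_on_disc[OF this]
  have pw: "power_series_on_disc w \<omega>" by (simp add: w_def[abs_def])
  have "toeplitz_contractive w"
    by (rule toeplitz_contractiveI[OF pw]) (use mobius_norm_le(2)[OF A bd] in \<open>simp add: \<omega>_def\<close>)
  note contr = toeplitz_contractive_norm[OF this]
  have w0: "w 0 = 0"
    using power_series_on_disc_0[OF pw] power_series_on_disc_0[OF ps] by (simp add: \<omega>_def)
  define b where "b k = (if k = 0 then 1 else 0) - cnj (a 0) * a k" for k
  have conv: "a (Suc i) = (\<Sum>j\<le>Suc i. w j * b (Suc i - j))" for i
  proof -
    let ?F = "Abs_fps a"
    have "(\<lambda>z. \<omega> z * (1 - cnj (a 0) * f z)) has_fps_expansion
        Abs_fps w * (1 - fps_const (cnj (a 0)) * ?F)"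
      by (intro fps_expansion_intros power_series_on_disc_has_fps_expansion pw ps)
    moreover have "(\<lambda>z. f z - a 0) has_fps_expansion (?F - fps_const (a 0))"
      by (intro fps_expansion_intros power_series_on_disc_has_fps_expansion ps)
    moreover have "\<forall>\<^sub>F z in nhds 0. f z - a 0 = \<omega> z * (1 - cnj (a 0) * f z)"
    proof -
      have "\<forall>\<^sub>F z in nhds 0. z \<in> ball (0::complex) 1"
        by (intro eventually_nhds_in_open) auto
      then show ?thesis
        by eventually_elim (use mobius_norm_le(1)[OF A bd] in \<open>simp add: \<omega>_def\<close>)
    qed
    ultimately have "Abs_fps w * (1 - fps_const (cnj (a 0)) * ?F) = ?F - fps_const (a 0)"
      by (rule has_fps_expansion_unique_ev)
    moreover have "1 - fps_const (cnj (a 0)) * ?F = Abs_fps b"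
      by (rule fps_ext) (simp add: b_def)
    ultimately have "fps_nth (Abs_fps w * Abs_fps b) (Suc i) = fps_nth (?F - fps_const (a 0)) (Suc i)"
      by simp
    then show ?thesis by (simp only: fps_mult_nth atLeast0AtMost) simp
  qed
  \<comment> \<open>In output degrees up to \<open>Suc n\<close> the coefficient
    \<open>b (Suc n)\<close> would only meet \<open>w 0 = 0\<close>; cutting it off is what ends the
    right-hand sum at \<open>n\<close>.\<close>
  define x where "x k = (if k \<le> n then b k else 0)" for k
  have "(\<Sum>j\<le>Suc i. w j * x (Suc i - j)) = a (Suc i)" if "i \<le> n" for i
    unfolding conv
  proof (rule sum.cong[OF refl])
    fix j show "w j * x (Suc i - j) = w j * b (Suc i - j)"
      using that w0 by (cases j) (auto simp: x_def)
  qed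
  then have "(\<Sum>k<Suc n. (cmod (a (Suc k)))\<^sup>2)
      = (\<Sum>k<Suc n. (cmod (\<Sum>j\<le>Suc k. w j * x (Suc k - j)))\<^sup>2)"
    by (intro sum.cong) auto
  also have "\<dots> \<le> (cmod (\<Sum>j\<le>0. w j * x (0 - j)))\<^sup>2
      + (\<Sum>k<Suc n. (cmod (\<Sum>j\<le>Suc k. w j * x (Suc k - j)))\<^sup>2)"
    by simp
  also have "\<dots> = (\<Sum>i\<le>Suc n. (cmod (\<Sum>j\<le>i. w j * x (i - j)))\<^sup>2)"
    by (simp only: lessThan_Suc_atMost[symmetric] sum.lessThan_Suc_shift)
  also have "\<dots> \<le> (\<Sum>i\<le>Suc n. (cmod (x i))\<^sup>2)"
    by (rule contr)
  also have "\<dots> = (\<Sum>i<Suc n. (cmod (b i))\<^sup>2)"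
    by (simp add: x_def lessThan_Suc_atMost)
  also have "\<dots> = (cmod (b 0))\<^sup>2 + (\<Sum>i<n. (cmod (b (Suc i)))\<^sup>2)"
    by (rule sum.lessThan_Suc_shift)
  also have "b 0 = of_real (1 - (cmod (a 0))\<^sup>2)"
    by (simp add: b_def complex_norm_square mult.commute del: of_real_power)
  also have "(cmod (of_real (1 - (cmod (a 0))\<^sup>2)))\<^sup>2 = (1 - (cmod (a 0))\<^sup>2)\<^sup>2"
    by (simp only: norm_of_real power2_abs)
  also have "(\<Sum>i<n. (cmod (b (Suc i)))\<^sup>2) = (cmod (a 0))\<^sup>2 * (\<Sum>k<n. (cmod (a (Suc k)))\<^sup>2)"
    by (simp add: b_def norm_mult power_mult_distrib sum_distrib_left)
  finally show ?thesis .
qed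

text \<open>The recursion of \<open>rogosinski_step\<close> is satisfied with equality by the
  geometric sums on the right. If \<open>|a\<^sub>0| = 1\<close>, where the Schwarz function
  degenerates, all later coefficients vanish.\<close>

lemma rogosinski:
  assumes hol: "f holomorphic_on ball 0 1" and ps: "power_series_on_disc a f"
    and bd: "\<And>z. z \<in> ball 0 1 \<Longrightarrow> cmod (f z) \<le> 1"
  shows "(\<Sum>k<n. (cmod (a (Suc k)))\<^sup>2) \<le> (1 - (cmod (a 0))\<^sup>2)\<^sup>2 * (\<Sum>k<n. ((cmod (a 0))\<^sup>2) ^ k)"
proof (cases "cmod (a 0) < 1")
  case True
  show ?thesis
  proof (induction n)
    case (Suc n)
    let ?A = "(cmod (a 0))\<^sup>2"
    have "(\<Sum>k<Suc n. (cmod (a (Suc k)))\<^sup>2) \<le> (1 - ?A)\<^sup>2 + ?A * (\<Sum>k<n. (cmod (a (Suc k)))\<^sup>2)"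
      by (rule rogosinski_step[OF hol ps bd True])
    also have "\<dots> \<le> (1 - ?A)\<^sup>2 + ?A * ((1 - ?A)\<^sup>2 * (\<Sum>k<n. ?A ^ k))"
      by (intro add_left_mono mult_left_mono Suc.IH) simp
    also have "\<dots> = (1 - ?A)\<^sup>2 * (1 + ?A * (\<Sum>k<n. ?A ^ k))"
      by (simp add: algebra_simps)
    also have "1 + ?A * (\<Sum>k<n. ?A ^ k) = (\<Sum>k<Suc n. ?A ^ k)"
      by (simp only: sum.lessThan_Suc_shift power_0 power_Suc sum_distrib_left)
    finally show ?case .
  qed simp
next
  case False
  note T = toeplitz_contractiveI[OF ps bd]
  have "cmod (a 0) = 1" using False toeplitz_contractive_coeff0_le[OF T] by simp
  then have "a (Suc k) = 0" for k
    using toeplitz_contractive_coeff_bound[OF T, of "Suc k"] by simp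
  then show ?thesis using \<open>cmod (a 0) = 1\<close> by simp
qed

text \<open>Summation by parts as an induction on a stronger bound: replacing \<open>w n\<close> by
  the smaller \<open>w (Suc n)\<close> in front of a nonpositive sum can only increase the
  product.\<close>

lemma abel_sum_nonpos:
  fixes w d :: "nat \<Rightarrow> real"
  assumes w: "\<And>n. 0 \<le> w n" "\<And>n. w (Suc n) \<le> w n" and d: "\<And>n. (\<Sum>k<n. d k) \<le> 0"
  shows "(\<Sum>k<n. w k * d k) \<le> 0"
proof -
  have "(\<Sum>k<Suc n. w k * d k) \<le> w n * (\<Sum>k<Suc n. d k)" for n
  proof (induction n)
    case (Suc n)
    have "w n * (\<Sum>k<Suc n. d k) \<le> w (Suc n) * (\<Sum>k<Suc n. d k)"
      using w(2)[of n] d[of "Suc n"] by (rule mult_right_mono_neg)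
    with Suc.IH show ?case by (simp add: algebra_simps)
  qed simp
  moreover have "w n * (\<Sum>k<Suc n. d k) \<le> 0" for n
    using w(1) d by (rule mult_nonneg_nonpos)
  ultimately have "(\<Sum>k<Suc n. w k * d k) \<le> 0" for n by (rule order_trans)
  then show ?thesis by (cases n) auto
qed

text \<open>\<open>d\<close> compares squared coefficients with those of the extremal function.
  Rogosinski's inequality makes its partial sums nonpositive, decreasing weights preserve this, and
  the bound is the closed form of the extremal series.\<close>

lemma area_series_bound:
  assumes hol: "f holomorphic_on ball 0 1" and ps: "power_series_on_disc a f"
    and bd: "\<And>z. z \<in> ball 0 1 \<Longrightarrow> cmod (f z) \<le> 1" and r: "0 \<le> r" "r\<^sup>2 \<le> 1 / 2"
  defines "A \<equiv> cmod (a 0)"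
  shows "(\<Sum>n. (Suc n) * (cmod (a (Suc n)))\<^sup>2 * r ^ (2 * Suc n))
      \<le> (1 - A\<^sup>2)\<^sup>2 * r\<^sup>2 / (1 - A\<^sup>2 * r\<^sup>2)\<^sup>2"
proof -
  note T = toeplitz_contractiveI[OF ps bd]
  have A: "0 \<le> A" "A \<le> 1" using toeplitz_contractive_coeff0_le[OF T] by (auto simp: A_def)
  define w where "w n = (Suc n) * r ^ (2 * Suc n)" for n
  have w0: "w n \<ge> 0" for n using r by (simp add: w_def)
  have wdec: "w (Suc n) \<le> w n" for n
  proof -
    have "w (Suc n) = (r ^ (2 * Suc n)) * ((real n + 2) * r\<^sup>2)"
      by (simp add: w_def power2_eq_square algebra_simps)
    also have "\<dots> \<le> (r ^ (2 * Suc n)) * ((real n + 2) * (1 / 2))"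
      using r by (intro mult_left_mono) auto
    \<comment> \<open>\<open>(n + 2) / 2 \<le> n + 1\<close> is an equality at \<open>n = 0\<close>;
      hence the threshold 1/2 for \<open>r\<^sup>2\<close>.\<close>
    also have "\<dots> \<le> (r ^ (2 * Suc n)) * real (Suc n)"
      using r by (intro mult_left_mono) auto
    finally show ?thesis by (simp add: w_def mult_ac)
  qed
  define d where "d n = (cmod (a (Suc n)))\<^sup>2 - (1 - A\<^sup>2)\<^sup>2 * (A\<^sup>2) ^ n" for n
  have "(\<Sum>k<n. d k) \<le> 0" for n
    using rogosinski[OF hol ps bd, of n]
    by (simp add: d_def sum_subtractf A_def sum_distrib_left)
  then have "(\<Sum>k<n. w k * d k) \<le> 0" for n
    by (intro abel_sum_nonpos w0 wdec)
  then have partial: "(\<Sum>k<n. w k * (cmod (a (Suc k)))\<^sup>2)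
      \<le> (\<Sum>k<n. w k * ((1 - A\<^sup>2)\<^sup>2 * (A\<^sup>2) ^ k))" for n
    by (simp add: d_def right_diff_distrib sum_subtractf)
  have "A\<^sup>2 * r\<^sup>2 \<le> 1 * (1 / 2)" using A r by (intro mult_mono) (auto simp: power_le_one)
  then have x: "norm (A\<^sup>2 * r\<^sup>2) < 1" by simp
  have "(\<lambda>k. (1 - A\<^sup>2)\<^sup>2 * r\<^sup>2 * (of_nat (Suc k) * (A\<^sup>2 * r\<^sup>2) ^ k))
      sums ((1 - A\<^sup>2)\<^sup>2 * r\<^sup>2 * (1 / (1 - A\<^sup>2 * r\<^sup>2)\<^sup>2))"
    by (intro sums_mult geometric_deriv_sums x)
  also have "(\<lambda>k. (1 - A\<^sup>2)\<^sup>2 * r\<^sup>2 * (of_nat (Suc k) * (A\<^sup>2 * r\<^sup>2) ^ k))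
      = (\<lambda>k. w k * ((1 - A\<^sup>2)\<^sup>2 * (A\<^sup>2) ^ k))"
  proof
    fix k
    have "r ^ (2 * Suc k) = r\<^sup>2 * (r\<^sup>2) ^ k" by (simp only: power_mult power_Suc)
    then show "(1 - A\<^sup>2)\<^sup>2 * r\<^sup>2 * (of_nat (Suc k) * (A\<^sup>2 * r\<^sup>2) ^ k)
      = w k * ((1 - A\<^sup>2)\<^sup>2 * (A\<^sup>2) ^ k)"
      by (simp only: w_def power_mult_distrib mult_ac of_nat_id)
  qed
  finally have maj: "(\<lambda>k. w k * ((1 - A\<^sup>2)\<^sup>2 * (A\<^sup>2) ^ k))
      sums ((1 - A\<^sup>2)\<^sup>2 * r\<^sup>2 / (1 - A\<^sup>2 * r\<^sup>2)\<^sup>2)" by simp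
  have bound: "(\<Sum>k<n. w k * (cmod (a (Suc k)))\<^sup>2) \<le> (1 - A\<^sup>2)\<^sup>2 * r\<^sup>2 / (1 - A\<^sup>2 * r\<^sup>2)\<^sup>2" for n
  proof -
    have "(\<Sum>k<n. w k * ((1 - A\<^sup>2)\<^sup>2 * (A\<^sup>2) ^ k)) \<le> (\<Sum>k. w k * ((1 - A\<^sup>2)\<^sup>2 * (A\<^sup>2) ^ k))"
      by (intro sum_le_suminf sums_summable[OF maj]) (use w0 in auto)
    with partial[of n] sums_unique[OF maj] show ?thesis by simp
  qed
  then have "summable (\<lambda>k. w k * (cmod (a (Suc k)))\<^sup>2)"
    by (intro summableI_nonneg_bounded) (use w0 in auto)
  from suminf_le_const[OF this bound] show ?thesis
    by (simp add: w_def mult_ac)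
qed

section \<open>The area functional as a power series\<close>

definition complex_of_vec :: "real^2 \<Rightarrow> complex" where
  "complex_of_vec x = Complex (x $ 1) (x $ 2)"

definition vec_of_complex :: "complex \<Rightarrow> real^2" where
  "vec_of_complex z = (\<chi> i. if i = 1 then Re z else Im z)"

lemma complex_of_vec_inverse [simp]:
  "complex_of_vec (vec_of_complex z) = z" "vec_of_complex (complex_of_vec x) = x"
  by (auto simp: complex_of_vec_def vec_of_complex_def vec_eq_iff forall_2)

lemma prod_Basis_vec: "(\<Prod>b\<in>Basis. x \<bullet> b) = (\<Prod>i\<in>UNIV. x $ i)" for x :: "real^'n"
  by (simp add: Basis_vec_def cart_eq_inner_axis axis_eq_axis prod.UNION_disjoint)

lemma complex_of_vec_vimage_box:
  "complex_of_vec -` box l u = box (vec_of_complex l) (vec_of_complex u)"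
  by (auto simp: mem_box_cart complex_of_vec_def vec_of_complex_def in_box_complex_iff forall_2)

lemma continuous_complex_of_vec: "continuous_on S complex_of_vec"
  unfolding complex_of_vec_def Complex_eq by (intro continuous_intros)

lemma measurable_complex_of_vec [measurable]: "complex_of_vec \<in> borel_measurable borel"
  by (intro borel_measurable_continuous_onI continuous_complex_of_vec)

text \<open>The library has invariance of Lebesgue measure under orthogonal maps only on \<open>real ^ 'n\<close>.\<close>

lemma lborel_complex_eq_distr: "(lborel :: complex measure) = distr lborel borel complex_of_vec"
proof (rule lborel_eqI)
  fix l u :: complex
  assume "\<And>b. b \<in> Basis \<Longrightarrow> l \<bullet> b \<le> u \<bullet> b"
  from this[of 1] this[of \<i>] have le: "Re l \<le> Re u" "Im l \<le> Im u"
    by (simp_all add: Basis_complex_def)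
  have "emeasure (distr lborel borel complex_of_vec) (box l u)
      = emeasure lborel (box (vec_of_complex l) (vec_of_complex u))"
    by (simp add: emeasure_distr complex_of_vec_vimage_box)
  also have "\<dots> = (\<Prod>b\<in>Basis. (vec_of_complex u - vec_of_complex l) \<bullet> b)"
    by (rule emeasure_lborel_box) (use le in \<open>auto simp: Basis_vec_def inner_axis vec_of_complex_def\<close>)
  also have "\<dots> = (\<Prod>b\<in>Basis. (u - l) \<bullet> b)"
    unfolding prod_Basis_vec UNIV_2 by (simp add: vec_of_complex_def Basis_complex_def)
  finally show "emeasure (distr lborel borel complex_of_vec) (box l u) = (\<Prod>b\<in>Basis. (u - l) \<bullet> b)" .
qed simp

lemma emeasure_complex_of_vec_vimage:
  "X \<in> sets borel \<Longrightarrow> emeasure lborel (complex_of_vec -` X) = emeasure lborel X"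
  using arg_cong[OF lborel_complex_eq_distr, of "\<lambda>M. emeasure M X"] by (simp add: emeasure_distr)

text \<open>It suffices to measure preimages of boxes. In \<open>real^2\<close> such a preimage is
  the image of a box under \<open>R\<close>, the inverse rotation, and orthogonal maps preserve
  measure.\<close>

lemma lborel_complex_rotation:
  assumes c: "cmod c = 1"
  shows "lborel = distr lborel borel (\<lambda>z. c * z)"
proof (rule lborel_eqI)
  fix l u :: complex
  assume le: "\<And>b. b \<in> Basis \<Longrightarrow> l \<bullet> b \<le> u \<bullet> b"
  define R where "R x = vec_of_complex (cnj c * complex_of_vec x)" for x
  let ?B = "box (vec_of_complex l) (vec_of_complex u)"
  have cc: "cnj c * c = 1" "c * cnj c = 1"
    using c by (simp_all add: complex_norm_square[symmetric] mult.commute)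
  have lin: "linear R"
    by (rule linearI) (simp_all add: R_def vec_of_complex_def complex_of_vec_def vec_eq_iff algebra_simps)
  have nrm: "norm (vec_of_complex z) = cmod z" for z
    by (simp add: norm_vec_def L2_set_def vec_of_complex_def UNIV_2 cmod_def)
  have "norm (R x) = norm x" for x
    using nrm[of "complex_of_vec x"] c by (simp add: R_def nrm norm_mult)
  with lin have orth: "orthogonal_transformation R" by (simp add: orthogonal_transformation)
  have img: "complex_of_vec -` ((\<lambda>z. c * z) -` box l u) = R ` ?B"
  proof -
    have "complex_of_vec -` ((\<lambda>z. c * z) -` box l u) = R ` (complex_of_vec -` box l u)"
    proof (intro equalityI subsetI)
      fix x assume x: "x \<in> complex_of_vec -` ((\<lambda>z. c * z) -` box l u)"
      have "x = R (vec_of_complex (c * complex_of_vec x))"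
        by (simp add: R_def mult.assoc[symmetric] cc)
      then show "x \<in> R ` (complex_of_vec -` box l u)" using x by (intro image_eqI) auto
    qed (auto simp: R_def mult.assoc[symmetric] cc)
    then show ?thesis by (simp add: complex_of_vec_vimage_box)
  qed
  have meas: "(\<lambda>z. c * z) \<in> borel_measurable borel" by simp
  have B: "?B \<in> lmeasurable" by (simp add: lmeasurable_box)
  have "emeasure (distr lborel borel (\<lambda>z. c * z)) (box l u) = emeasure lborel ((\<lambda>z. c * z) -` box l u)"
    by (subst emeasure_distr) auto
  also have "\<dots> = emeasure lborel (complex_of_vec -` ((\<lambda>z. c * z) -` box l u))"
    using measurable_sets[OF meas, of "box l u"]
    by (subst emeasure_complex_of_vec_vimage) auto
  \<comment> \<open>The rotated box is Borel, so its \<open>lborel\<close> measure agrees with the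
    completed one, for which \<open>measure_orthogonal_image\<close> is stated.\<close>
  also have "\<dots> = emeasure lebesgue (R ` ?B)"
  proof -
    have "complex_of_vec -` ((\<lambda>z. c * z) -` box l u) \<in> sets lborel"
      using measurable_sets[OF measurable_complex_of_vec measurable_sets[OF meas, of "box l u"]]
      by simp
    then show ?thesis unfolding img by simp
  qed
  also have "\<dots> = emeasure lebesgue ?B"
    using measure_orthogonal_image[OF orth B] measurable_orthogonal_image[OF orth B] B
    by (metis emeasure_eq_measure2 fmeasurableD2 ennreal_enn2real measure_def)
  also have "\<dots> = emeasure lborel (complex_of_vec -` box l u)"
    by (simp add: complex_of_vec_vimage_box)
  also have "\<dots> = emeasure lborel (box l u)"
    by (rule emeasure_complex_of_vec_vimage) simp
  also have "\<dots> = (\<Prod>b\<in>Basis. (u - l) \<bullet> b)"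
    by (rule emeasure_lborel_box[OF le])
  finally show "emeasure (distr lborel borel (\<lambda>z. c * z)) (box l u) = (\<Prod>b\<in>Basis. (u - l) \<bullet> b)" .
qed simp

section \<open>Integrals of monomials and polynomials over discs\<close>

lemma set_integrable_ball:
  fixes g :: "complex \<Rightarrow> 'b::{banach, second_countable_topology}"
  assumes "continuous_on UNIV g"
  shows "set_integrable lborel (ball 0 r) g"
proof (rule set_integrable_subset)
  show "set_integrable lborel (cball 0 r) g"
    unfolding set_integrable_def using assms
    by (intro borel_integrable_compact) (auto intro: continuous_on_subset)
qed auto

lemma integral_ball_rotation:
  fixes g :: "complex \<Rightarrow> complex"
  assumes "g \<in> borel_measurable borel" "cmod c = 1"
  shows "(LINT w:ball 0 r|lborel. g (c * w)) = (LINT w:ball 0 r|lborel. g w)"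
proof -
  have "(LINT w:ball 0 r|lborel. g w) = (LINT w|distr lborel borel (\<lambda>z. c * z). indicator (ball 0 r) w *\<^sub>R g w)"
    unfolding set_lebesgue_integral_def by (subst lborel_complex_rotation[OF assms(2)]) simp
  also have "\<dots> = (LINT w|lborel. indicator (ball 0 r) (c * w) *\<^sub>R g (c * w))"
    by (rule integral_distr)
      (use assms in \<open>auto intro!: borel_measurable_scaleR borel_measurable_indicator\<close>)
  also have "(\<lambda>w. indicator (ball 0 r) (c * w) *\<^sub>R g (c * w)) = (\<lambda>w. indicator (ball 0 r) w *\<^sub>R g (c * w))"
    by (auto simp: indicator_def norm_mult assms(2))
  finally show ?thesis by (simp add: set_lebesgue_integral_def)
qed

text \<open>Rotation by the angle \<open>pi / (j - k)\<close> multiplies the integrand by -1, so the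
  integral equals its own negative.\<close>

lemma integral_ball_monomials_orthogonal:
  assumes "j \<noteq> k"
  shows "(LINT w:ball 0 r|lborel. w ^ j * cnj (w ^ k)) = 0"
proof -
  define c where "c = cis (pi / (real j - real k))"
  have "c ^ j * cnj (c ^ k) = cis (real j * (pi / (real j - real k)) + - (real k * (pi / (real j - real k))))"
    by (simp only: c_def Complex.DeMoivre cis_cnj cis_mult)
  also have "real j * (pi / (real j - real k)) + - (real k * (pi / (real j - real k))) = pi"
    using assms by (simp add: divide_simps) (simp add: algebra_simps)
  finally have c: "c ^ j * cnj (c ^ k) = - 1" by simp
  have "(LINT w:ball 0 r|lborel. w ^ j * cnj (w ^ k))
      = (LINT w:ball 0 r|lborel. (c * w) ^ j * cnj ((c * w) ^ k))"
    by (rule integral_ball_rotation[symmetric])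
      (auto simp: c_def intro!: borel_measurable_continuous_onI continuous_intros)
  also have "(\<lambda>w. (c * w) ^ j * cnj ((c * w) ^ k)) = (\<lambda>w. - 1 * (w ^ j * cnj (w ^ k)))"
    unfolding c[symmetric] by (auto simp: power_mult_distrib mult_ac)
  finally have "(LINT w:ball 0 r|lborel. w ^ j * cnj (w ^ k))
      = - 1 * (LINT w:ball 0 r|lborel. w ^ j * cnj (w ^ k))"
    by (simp only: set_integral_mult_right)
  then show ?thesis by simp
qed

lemma measure_ball_complex: "0 \<le> r \<Longrightarrow> measure lborel (ball (0::complex) r) = pi * r\<^sup>2"
  by (simp add: content_ball unit_ball_vol_2)

definition disc_moment :: "nat \<Rightarrow> real \<Rightarrow> real" where
  "disc_moment k r = (LINT w:ball (0::complex) r|lborel. cmod w ^ (2 * k))"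

lemma disc_moment_scale:
  assumes "0 < r"
  shows "disc_moment k r = r ^ (2 * Suc k) * disc_moment k 1"
proof -
  let ?g = "\<lambda>r w. indicator (ball 0 r) w * cmod w ^ (2 * k)"
  have [measurable]: "?g r \<in> borel_measurable borel" for r
    by (intro borel_measurable_times borel_measurable_indicator)
      (auto intro!: borel_measurable_continuous_onI continuous_intros)
  have "disc_moment k r = (LINT w|density (distr lborel borel (\<lambda>x. 0 + r *\<^sub>R x)) (\<lambda>_. \<bar>r\<bar> ^ DIM(complex)). ?g r w)"
    unfolding disc_moment_def set_lebesgue_integral_def
    by (subst lborel_affine[of r 0]) (use assms in auto)
  also have "\<dots> = (LINT w|distr lborel borel (\<lambda>x. 0 + r *\<^sub>R x). r\<^sup>2 *\<^sub>R ?g r w)"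
    using assms by (subst integral_density) auto
  also have "\<dots> = (LINT w|lborel. r\<^sup>2 *\<^sub>R ?g r (0 + r *\<^sub>R w))"
    by (rule integral_distr) auto
  also have "(\<lambda>w. r\<^sup>2 *\<^sub>R ?g r (0 + r *\<^sub>R w)) = (\<lambda>w. r ^ (2 * Suc k) *\<^sub>R ?g 1 w)"
    using assms by (auto simp: indicator_def power_mult_distrib power2_eq_square)
  finally show ?thesis
    unfolding disc_moment_def set_lebesgue_integral_def by simp
qed

text \<open>Comparing with the annulus \<open>s \<le> |w| < 1\<close> and using the scaling law, both bounds tend to \<open>\<pi>\<close>
  as \<open>s \<rightarrow> 1\<close>; this avoids polar coordinates.\<close>

lemma disc_moment_unit: "disc_moment k 1 = pi / Suc k"
proof -
  let ?m = "disc_moment k 1"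
  let ?h = "\<lambda>w::complex. cmod w ^ (2 * k)"
  have int: "set_integrable lborel (ball 0 r) ?h" for r
    by (intro set_integrable_ball continuous_intros)
  have annulus: "s ^ (2 * k) * pi \<le> ?m * (\<Sum>i\<le>k. (s\<^sup>2) ^ i) \<and> ?m * (\<Sum>i\<le>k. (s\<^sup>2) ^ i) \<le> pi"
    if s: "0 < s" "s < 1" for s
  proof -
    let ?A = "ball 0 1 - ball (0::complex) s"
    have s2: "s\<^sup>2 < 1" using s by (simp add: power_less_one_iff)
    have sub: "ball (0::complex) s \<subseteq> ball 0 1" using s by auto
    have intA: "set_integrable lborel ?A ?h" by (rule set_integrable_subset[OF int]) auto
    have fin: "emeasure lborel ?A < \<infinity>"
      by (rule le_less_trans[OF emeasure_mono emeasure_lborel_ball_finite[of 0 1]]) auto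
    have mA: "measure lborel ?A = pi * (1 - s\<^sup>2)"
      using s sub emeasure_lborel_ball_finite[of "0::complex" 1]
      by (subst measure_Diff) (auto simp: measure_ball_complex algebra_simps)
    have const: "set_integrable lborel ?A (\<lambda>_. c)" for c :: real
      by (rule set_integrable_subset[OF set_integrable_ball[of _ 1]]) auto
    have cint: "(LINT w:?A|lborel. c) = c * (pi * (1 - s\<^sup>2))" for c
      using fin by (simp add: set_lebesgue_integral_def mA)
    have eq: "disc_moment k 1 = disc_moment k s + (LINT w:?A|lborel. ?h w)"
    proof -
      have "ball (0::complex) 1 = ball 0 s \<union> ?A" using sub by auto
      then have "disc_moment k 1 = (LINT w:ball 0 s \<union> ?A|lborel. ?h w)"
        by (simp add: disc_moment_def)
      also have "\<dots> = disc_moment k s + (LINT w:?A|lborel. ?h w)"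
        unfolding disc_moment_def by (rule set_integral_Un) (use int intA in auto)
      finally show ?thesis .
    qed
    have "(LINT w:?A|lborel. s ^ (2 * k)) \<le> (LINT w:?A|lborel. ?h w)"
      by (rule set_integral_mono[OF const intA]) (use s in \<open>auto intro!: power_mono\<close>)
    then have lo: "s ^ (2 * k) * (pi * (1 - s\<^sup>2)) \<le> (LINT w:?A|lborel. ?h w)"
      by (simp add: cint)
    have "(LINT w:?A|lborel. ?h w) \<le> (LINT w:?A|lborel. 1)"
      by (rule set_integral_mono[OF intA const]) (auto intro!: power_le_one)
    then have hi: "(LINT w:?A|lborel. ?h w) \<le> pi * (1 - s\<^sup>2)"
      by (simp add: cint)
    \<comment> \<open>By scaling, the annulus integral is \<open>?m * (1 - s ^ (2 * Suc k))\<close>.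
      Cancelling the factor \<open>1 - s\<^sup>2\<close> of the annulus area leaves a polynomial in
      \<open>s\<close> whose \<open>k + 1\<close> summands all equal 1 at
      \<open>s = 1\<close>.\<close>
    have geo: "1 - s ^ (2 * Suc k) = (1 - s\<^sup>2) * (\<Sum>i\<le>k. (s\<^sup>2) ^ i)"
      using one_diff_power_eq[of "s\<^sup>2" "Suc k"] by (simp only: power_mult lessThan_Suc_atMost)
    have "(LINT w:?A|lborel. ?h w) = ?m * (1 - s ^ (2 * Suc k))"
      using eq disc_moment_scale[OF s(1), of k] by (simp add: algebra_simps)
    also have "\<dots> = (?m * (\<Sum>i\<le>k. (s\<^sup>2) ^ i)) * (1 - s\<^sup>2)"
      unfolding geo by (simp only: mult_ac)
    finally have "(LINT w:?A|lborel. ?h w) = (?m * (\<Sum>i\<le>k. (s\<^sup>2) ^ i)) * (1 - s\<^sup>2)" .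
    then have "(s ^ (2 * k) * pi) * (1 - s\<^sup>2) \<le> (?m * (\<Sum>i\<le>k. (s\<^sup>2) ^ i)) * (1 - s\<^sup>2)"
      "(?m * (\<Sum>i\<le>k. (s\<^sup>2) ^ i)) * (1 - s\<^sup>2) \<le> pi * (1 - s\<^sup>2)"
      using lo hi by (simp_all only: mult.assoc)
    then show ?thesis using s2 by simp
  qed
  have ev: "\<forall>\<^sub>F s in at_left (1::real). 0 < s \<and> s < 1"
    using eventually_at_left_real[OF zero_less_one] by (rule eventually_mono) simp
  have lim: "((\<lambda>s. ?m * (\<Sum>i\<le>k. (s\<^sup>2) ^ i)) \<longlongrightarrow> ?m * (\<Sum>i\<le>k. (1\<^sup>2) ^ i)) (at_left 1)"
    "((\<lambda>s. s ^ (2 * k) * pi) \<longlongrightarrow> 1 ^ (2 * k) * pi) (at_left (1::real))"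
    by (intro tendsto_intros)+
  have "?m * (\<Sum>i\<le>k. (1\<^sup>2) ^ i) \<le> pi"
    by (rule tendsto_upperbound[OF lim(1)]) (use ev annulus in \<open>auto elim!: eventually_mono\<close>)
  moreover have "1 ^ (2 * k) * pi \<le> ?m * (\<Sum>i\<le>k. (1\<^sup>2) ^ i)"
    by (rule tendsto_le[OF _ lim]) (use ev annulus in \<open>auto elim!: eventually_mono\<close>)
  ultimately have "?m * Suc k = pi" by simp
  then show ?thesis by (simp add: field_simps)
qed

lemma set_integrable_sum_fun:
  fixes g :: "'i \<Rightarrow> 'a \<Rightarrow> 'b::{banach, second_countable_topology}"
  assumes "\<And>i. i \<in> I \<Longrightarrow> set_integrable M A (g i)"
  shows "set_integrable M A (\<lambda>x. \<Sum>i\<in>I. g i x)"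
  using assms unfolding set_integrable_def scaleR_sum_right
  by (rule Bochner_Integration.integrable_sum)

lemma set_integral_sum_fun:
  fixes g :: "'i \<Rightarrow> 'a \<Rightarrow> 'b::{banach, second_countable_topology}"
  assumes "\<And>i. i \<in> I \<Longrightarrow> set_integrable M A (g i)"
  shows "(LINT x:A|M. \<Sum>i\<in>I. g i x) = (\<Sum>i\<in>I. LINT x:A|M. g i x)"
  using assms unfolding set_integrable_def set_lebesgue_integral_def scaleR_sum_right
  by (rule Bochner_Integration.integral_sum)

lemma integral_ball_polynomial_norm:
  assumes "0 < r"
  shows "(LINT w:ball 0 r|lborel. (cmod (\<Sum>n<N. b n * w ^ n))\<^sup>2)
    = (\<Sum>n<N. (cmod (b n))\<^sup>2 * (pi * r ^ (2 * Suc n) / Suc n))"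
proof -
  let ?B = "ball (0::complex) r"
  have diag: "(LINT w:?B|lborel. w ^ j * cnj (w ^ j)) = of_real (pi * r ^ (2 * Suc j) / Suc j)" for j
  proof -
    have "(LINT w:?B|lborel. w ^ j * cnj (w ^ j)) = (LINT w:?B|lborel. complex_of_real (cmod w ^ (2 * j)))"
      by (simp only: complex_norm_square[symmetric] norm_power power_mult[symmetric] mult.commute)
    also have "\<dots> = of_real (disc_moment j r)"
      unfolding disc_moment_def by (rule set_integral_complex_of_real)
    also have "disc_moment j r = pi * r ^ (2 * Suc j) / Suc j"
      unfolding disc_moment_scale[OF assms] disc_moment_unit by simp
    finally show ?thesis .
  qed
  have int: "set_integrable lborel ?B (\<lambda>w. c * (w ^ j * cnj (w ^ k)))" for c j k
    by (intro set_integrable_ball continuous_intros)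
  have "complex_of_real (LINT w:?B|lborel. (cmod (\<Sum>n<N. b n * w ^ n))\<^sup>2)
      = (LINT w:?B|lborel. complex_of_real ((cmod (\<Sum>n<N. b n * w ^ n))\<^sup>2))"
    by (rule set_integral_complex_of_real[symmetric])
  also have "(\<lambda>w. complex_of_real ((cmod (\<Sum>n<N. b n * w ^ n))\<^sup>2))
     = (\<lambda>w. \<Sum>j<N. \<Sum>k<N. (b j * cnj (b k)) * (w ^ j * cnj (w ^ k)))"
    unfolding complex_norm_square by (simp add: sum_product mult_ac)
  also have "(LINT w:?B|lborel. \<Sum>j<N. \<Sum>k<N. (b j * cnj (b k)) * (w ^ j * cnj (w ^ k)))
      = (\<Sum>j<N. \<Sum>k<N. (b j * cnj (b k)) * (LINT w:?B|lborel. w ^ j * cnj (w ^ k)))"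
    by (simp only: set_integral_sum_fun set_integrable_sum_fun int set_integral_mult_right)
  also have "\<dots> = (\<Sum>j<N. \<Sum>k<N. if k = j then (b j * cnj (b k)) * of_real (pi * r ^ (2 * Suc j) / Suc j) else 0)"
  proof (intro sum.cong refl)
    fix j k
    show "(b j * cnj (b k)) * (LINT w:?B|lborel. w ^ j * cnj (w ^ k))
        = (if k = j then (b j * cnj (b k)) * of_real (pi * r ^ (2 * Suc j) / Suc j) else 0)"
      using diag[of j] integral_ball_monomials_orthogonal[of j k r]
      by (cases "k = j") (simp_all only: if_True if_False mult_zero_right refl not_sym simp_thms)
  qed
  also have "\<dots> = (\<Sum>j<N. (b j * cnj (b j)) * of_real (pi * r ^ (2 * Suc j) / Suc j))"
    by (intro sum.cong refl) (simp only: sum.delta finite_lessThan if_True)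
  also have "\<dots> = of_real (\<Sum>n<N. (cmod (b n))\<^sup>2 * (pi * r ^ (2 * Suc n) / Suc n))"
    by (simp only: of_real_sum of_real_mult complex_norm_square)
  finally show ?thesis by (simp only: of_real_eq_iff)
qed

section \<open>The area as a coefficient series\<close>

lemma power_series_on_disc_deriv:
  assumes ps: "power_series_on_disc a f"
  shows "power_series_on_disc (diffs a) (deriv f)"
  unfolding power_series_on_disc_def
proof
  fix z :: complex assume z: "z \<in> ball 0 1"
  have sm: "summable (\<lambda>n. a n * w ^ n)" if "cmod w < 1" for w
    using ps that unfolding power_series_on_disc_def by (intro sums_summable[of _ "f w"]) auto
  have "summable (\<lambda>n. diffs a n * z ^ n)"
    using z sm by (intro termdiff_converges[of _ 1]) auto
  moreover have "deriv f z = (\<Sum>n. diffs a n * z ^ n)"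
  proof (rule DERIV_imp_deriv)
    obtain K where K: "cmod z < K" "K < 1" using z dense[of "cmod z" 1] by auto
    have "((\<lambda>x. \<Sum>n. a n * x ^ n) has_field_derivative (\<Sum>n. diffs a n * z ^ n)) (at z)"
      by (rule termdiffs_strong[of _ "of_real K"])
        (use K sm[of "of_real K"] le_less_trans[OF norm_ge_zero K(1)] in auto)
    then show "(f has_field_derivative (\<Sum>n. diffs a n * z ^ n)) (at z)"
    proof (rule has_field_derivative_transform_within_open[OF _ open_ball z])
      fix x :: complex assume "x \<in> ball 0 1"
      then show "(\<Sum>n. a n * x ^ n) = f x"
        using ps unfolding power_series_on_disc_def by (auto simp: sums_iff)
    qed
  qed
  ultimately show "(\<lambda>n. diffs a n * z ^ n) sums deriv f z" by (simp add: summable_sums)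
qed

text \<open>Dominated convergence for the partial sums of the derivative: on the ball of radius
  \<open>r\<close> they are bounded by \<open>K\<close>, the absolute series of the derivative at
  \<open>r\<close>.\<close>

lemma S_area_sums:
  assumes ps: "power_series_on_disc a f" and r: "0 < r" "r < 1"
  shows "(\<lambda>n. pi * (Suc n * (cmod (a (Suc n)))\<^sup>2 * r ^ (2 * Suc n))) sums S_area f r"
proof -
  let ?B = "ball (0::complex) r"
  define b where "b = diffs a"
  have psb: "power_series_on_disc b (deriv f)"
    unfolding b_def by (rule power_series_on_disc_deriv[OF ps])
  have smb: "summable (\<lambda>n. cmod (b n) * r ^ n)"
    by (rule power_series_on_disc_abs_summable[OF psb]) (use r in auto)
  define K where "K = (\<Sum>n. cmod (b n) * r ^ n)"
  let ?p = "\<lambda>N w. indicator ?B w *\<^sub>R (cmod (\<Sum>n<N. b n * w ^ n))\<^sup>2"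
  let ?d = "\<lambda>w. indicator ?B w *\<^sub>R (cmod (deriv f w))\<^sup>2"
  have lim: "(\<lambda>N. ?p N w) \<longlonglongrightarrow> ?d w" for w
  proof (cases "w \<in> ?B")
    case True
    then have "w \<in> ball 0 1" using r by auto
    then have "(\<lambda>n. b n * w ^ n) sums deriv f w"
      using psb unfolding power_series_on_disc_def by blast
    then show ?thesis unfolding sums_def by (intro tendsto_intros)
  qed simp
  have meas: "?p N \<in> borel_measurable lborel" for N
    by (intro borel_measurable_scaleR borel_measurable_indicator)
      (auto intro!: borel_measurable_continuous_onI continuous_intros)
  have bound: "norm (?p N w) \<le> indicator ?B w *\<^sub>R K\<^sup>2" for N w
  proof (cases "w \<in> ?B")
    case True
    have "cmod (\<Sum>n<N. b n * w ^ n) \<le> (\<Sum>n<N. cmod (b n) * r ^ n)"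
      using True r by (intro sum_norm_le) (auto simp: norm_mult norm_power intro!: mult_left_mono power_mono)
    also have "\<dots> \<le> K"
      unfolding K_def by (rule sum_le_suminf[OF smb]) (use r in auto)
    finally show ?thesis using True by (simp add: power_mono)
  qed simp
  have "(\<lambda>N. integral\<^sup>L lborel (?p N)) \<longlonglongrightarrow> integral\<^sup>L lborel ?d"
  proof (rule integral_dominated_convergence)
    show "?d \<in> borel_measurable lborel"
      by (rule borel_measurable_LIMSEQ_real[OF lim meas])
    show "integrable lborel (\<lambda>w. indicator ?B w *\<^sub>R K\<^sup>2)"
      using set_integrable_ball[of "\<lambda>_. K\<^sup>2" r] by (simp add: set_integrable_def)
  qed (use lim bound meas in auto)
  then have "(\<lambda>N. \<Sum>n<N. (cmod (b n))\<^sup>2 * (pi * r ^ (2 * Suc n) / Suc n)) \<longlonglongrightarrow> S_area f r"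
    unfolding S_area_def integral_ball_polynomial_norm[OF r(1), symmetric] set_lebesgue_integral_def .
  \<comment> \<open>Since \<open>b n = (n + 1) * a (n + 1)\<close>, one of its two squared factors
    \<open>n + 1\<close> cancels against the moment.\<close>
  moreover have "(cmod (b n))\<^sup>2 * (pi * r ^ (2 * Suc n) / Suc n)
      = pi * (Suc n * (cmod (a (Suc n)))\<^sup>2 * r ^ (2 * Suc n))" for n
    unfolding b_def diffs_def norm_mult norm_of_nat power_mult_distrib
    by (simp add: power2_eq_square field_simps)
  ultimately show ?thesis by (simp add: sums_def)
qed

section \<open>Sharp inequality\<close>

text \<open>\<open>B\<close> is the area of \<open>f\<^sub>a\<close> divided by \<open>pi\<close>.
  The denominator of the quotient is a difference of squares, and its two factors split once more,
  into \<open>(1 - r) * (1 + a\<^sup>2 * r)\<close> and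
  \<open>(1 + r) * (1 - a\<^sup>2 * r)\<close>.\<close>

lemma area_quotient:
  fixes a r :: real
  assumes "0 \<le> a" "a \<le> 1" "0 < r" "r < 1"
  defines "B \<equiv> (1 - a\<^sup>2)\<^sup>2 * r\<^sup>2 / (1 - a\<^sup>2 * r\<^sup>2)\<^sup>2"
  shows "B < 1" and "B / (1 - B) = (1 - a\<^sup>2)\<^sup>2 * r\<^sup>2 / ((1 - r\<^sup>2) * (1 - a ^ 4 * r\<^sup>2))"
proof -
  define D where "D = (1 - a\<^sup>2 * r\<^sup>2)\<^sup>2"
  define M where "M = (1 - a\<^sup>2)\<^sup>2 * r\<^sup>2"
  have r2: "r\<^sup>2 < 1" using assms by (simp add: power_less_one_iff)
  have "a\<^sup>2 * r\<^sup>2 \<le> 1 * r\<^sup>2" "a ^ 4 * r\<^sup>2 \<le> 1 * r\<^sup>2"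
    using assms by (intro mult_right_mono power_le_one; simp)+
  with r2 have pos: "0 < 1 - a\<^sup>2 * r\<^sup>2" "0 < 1 - r\<^sup>2" "0 < 1 - a ^ 4 * r\<^sup>2" by auto
  then have D: "D > 0" by (simp add: D_def)
  have diff: "D - M = (1 - r\<^sup>2) * (1 - a ^ 4 * r\<^sup>2)"
    unfolding D_def M_def by algebra
  then have DM: "D - M > 0" using pos by simp
  have B: "B = M / D" by (simp add: B_def D_def M_def)
  show "B < 1" using D DM by (simp add: B)
  have "B / (1 - B) = M / (D - M)" using D DM by (simp add: B field_simps)
  then show "B / (1 - B) = (1 - a\<^sup>2)\<^sup>2 * r\<^sup>2 / ((1 - r\<^sup>2) * (1 - a ^ 4 * r\<^sup>2))"
    unfolding diff by (simp only: M_def)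
qed

text \<open>The value of \<open>S\<^sub>r / (pi - S\<^sub>r)\<close> for \<open>f\<^sub>a\<close> at
  \<open>r = 1 / (3 - a)\<close>.\<close>

definition extremal_quotient :: "real \<Rightarrow> real" where
  "extremal_quotient a = (1 - a\<^sup>2)\<^sup>2 * (3 - a)\<^sup>2 / ((2 - a) * (4 - a) * ((3 - a)\<^sup>2 - a ^ 4))"

lemma area_quotient_extremal_radius:
  fixes a :: real
  assumes "0 \<le> a" "a \<le> 1"
  defines "r \<equiv> 1 / (3 - a)"
  shows "(1 - a\<^sup>2)\<^sup>2 * r\<^sup>2 / ((1 - r\<^sup>2) * (1 - a ^ 4 * r\<^sup>2)) = extremal_quotient a"
proof -
  define u where "u = 3 - a"
  have u: "u > 0" using assms by (simp add: u_def)
  have "(2 - a) * (4 - a) = u\<^sup>2 - 1" unfolding u_def by algebra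
  moreover have "1 - r\<^sup>2 = (u\<^sup>2 - 1) / u\<^sup>2" "1 - a ^ 4 * r\<^sup>2 = (u\<^sup>2 - a ^ 4) / u\<^sup>2"
    using u unfolding r_def u_def[symmetric] by (simp_all add: power_divide field_simps)
  moreover have "r\<^sup>2 = 1 / u\<^sup>2" by (simp add: r_def u_def power_divide)
  ultimately show ?thesis
    using u unfolding extremal_quotient_def u_def[symmetric] by (simp add: power2_eq_square)
qed

lemma area_quotient_le_extremal:
  fixes a r :: real
  assumes a: "0 \<le> a" "a \<le> 1" and r: "0 < r" "r \<le> 1 / (3 - a)"
  shows "(1 - a\<^sup>2)\<^sup>2 * r\<^sup>2 / ((1 - r\<^sup>2) * (1 - a ^ 4 * r\<^sup>2)) \<le> extremal_quotient a"
proof -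
  define s where "s = 1 / (3 - a)"
  have s: "r \<le> s" "s < 1" "0 < s" using a r by (auto simp: s_def)
  have sq: "r\<^sup>2 \<le> s\<^sup>2" "s\<^sup>2 < 1" using s r by (auto intro: power_mono simp: power_less_one_iff)
  have a4: "0 \<le> a ^ 4" "a ^ 4 \<le> 1" using a by (auto simp: power_le_one)
  have "a ^ 4 * s\<^sup>2 \<le> 1 * s\<^sup>2" "a ^ 4 * r\<^sup>2 \<le> a ^ 4 * s\<^sup>2"
    using a4 sq by (intro mult_right_mono mult_left_mono; simp)+
  then have "(1 - a\<^sup>2)\<^sup>2 * r\<^sup>2 / ((1 - r\<^sup>2) * (1 - a ^ 4 * r\<^sup>2))
      \<le> (1 - a\<^sup>2)\<^sup>2 * s\<^sup>2 / ((1 - s\<^sup>2) * (1 - a ^ 4 * s\<^sup>2))"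
    using sq by (intro frac_le mult_left_mono mult_mono mult_pos_pos) auto
  then show ?thesis unfolding s_def area_quotient_extremal_radius[OF a] .
qed

lemma extremal_identity:
  assumes "0 \<le> a" "a < 1"
  shows "a\<^sup>2 + (1 - a\<^sup>2) / (2 - a) + 9 / 8 * extremal_quotient a + ratio a * (extremal_quotient a)\<^sup>2 = 1"
proof -
  have "(1 - a\<^sup>2) / (2 - a) + (1 - a\<^sup>2) * (1 - a) / (2 - a) = ((1 - a\<^sup>2) * (2 - a)) / (2 - a)"
    unfolding add_divide_distrib[symmetric] by (simp add: algebra_simps)
  also have "\<dots> = 1 - a\<^sup>2" using assms by simp
  finally show ?thesis
    using ratio_eq_slack[OF assms] unfolding extremal_quotient_def[symmetric] by linarith
qed

lemma radius_ratio_le: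
  fixes a r :: real
  assumes "a \<le> 1" "0 < r" "r \<le> 1 / (3 - a)"
  shows "r / (1 - r) \<le> 1 / (2 - a)"
proof -
  have "r * (3 - a) \<le> 1" using assms by (simp add: field_simps)
  moreover have "1 / (3 - a) \<le> 1 / 2" using assms by (intro divide_left_mono) auto
  then have "r < 1" using assms by linarith
  ultimately show ?thesis using assms by (simp add: field_simps)
qed

lemma bohr_inequality:
  assumes hol: "f holomorphic_on ball 0 1" and ps: "power_series_on_disc a f"
    and bd: "\<And>z. z \<in> ball 0 1 \<Longrightarrow> cmod (f z) \<le> 1"
    and r: "0 < r" "r < 1" "r \<le> 1 / (3 - cmod (a 0))"
  shows "bohr_lhs a f r \<le> 1"
proof -
  define A where "A = cmod (a 0)"
  note T = toeplitz_contractiveI[OF ps bd]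
  have A: "0 \<le> A" "A \<le> 1" using toeplitz_contractive_coeff0_le[OF T] by (auto simp: A_def)
  \<comment> \<open>The radius condition thus gives \<open>r\<^sup>2 \<le> 1 / 4\<close>, well
    within the range of \<open>area_series_bound\<close>.\<close>
  have "1 / (3 - A) \<le> 1 / 2" using A by (intro divide_left_mono) auto
  then have "r \<le> 1 / 2" using r unfolding A_def by linarith
  then have "r\<^sup>2 \<le> (1 / 2)\<^sup>2" using r by (intro power_mono) auto
  then have r2: "r\<^sup>2 \<le> 1 / 2" by (simp add: power2_eq_square)
  define g where "g n = real (Suc n) * (cmod (a (Suc n)))\<^sup>2 * r ^ (2 * Suc n)" for n
  define X where "X = S_area f r / pi"
  define B where "B = (1 - A\<^sup>2)\<^sup>2 * r\<^sup>2 / (1 - A\<^sup>2 * r\<^sup>2)\<^sup>2"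
  have "(\<lambda>n. pi * g n) sums (pi * X)"
    using S_area_sums[OF ps r(1,2)] by (simp add: g_def X_def)
  then have gX: "g sums X" by (subst (asm) sums_mult_iff) simp_all
  have "g n \<ge> 0" for n using r by (simp add: g_def)
  then have X0: "0 \<le> X" using sums_le[OF _ sums_zero gX] by simp
  have XB: "X \<le> B"
    using area_series_bound[OF hol ps bd _ r2] r sums_unique[OF gX]
    by (simp add: g_def[abs_def] A_def B_def)
  have B1: "B < 1" and BB: "B / (1 - B) = (1 - A\<^sup>2)\<^sup>2 * r\<^sup>2 / ((1 - r\<^sup>2) * (1 - A ^ 4 * r\<^sup>2))"
    unfolding B_def using area_quotient[OF A r(1,2)] by blast+
  define q where "q = S_area f r / (pi - S_area f r)"
  have "q = X / (1 - X)"
  proof -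
    have "S_area f r = pi * X" by (simp add: X_def)
    then have "q = (pi * X) / (pi * (1 - X))" by (simp add: q_def algebra_simps)
    then show ?thesis by simp
  qed
  moreover have "X / (1 - X) \<le> B / (1 - B)"
    using X0 XB B1 by (intro frac_le) auto
  moreover have "B / (1 - B) \<le> extremal_quotient A"
    unfolding BB using area_quotient_le_extremal[OF A r(1)] r(3) by (simp add: A_def)
  ultimately have q: "0 \<le> q" "q \<le> extremal_quotient A" using X0 XB B1 by auto
  have "bohr_lhs a f r = A\<^sup>2 + ((\<Sum>n. cmod (a (Suc n)) * r ^ Suc n)
      + (1 / (1 + A) + r / (1 - r)) * (\<Sum>n. (cmod (a (Suc n)))\<^sup>2 * r ^ (2 * Suc n)))
      + 9 / 8 * q + lambda_const * q\<^sup>2"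
    by (simp add: bohr_lhs_def A_def q_def)
  also have "\<dots> \<le> A\<^sup>2 + (1 - A\<^sup>2) * (r / (1 - r)) + 9 / 8 * q + lambda_const * q\<^sup>2"
    using refined_bohr[OF T _ r(2)] r(1) by (simp add: A_def)
  \<comment> \<open>Increasing \<open>q\<close> in the quadratic term is legitimate because
    \<open>lambda_const\<close> is positive, by its lower bound.\<close>
  also have "\<dots> \<le> A\<^sup>2 + (1 - A\<^sup>2) * (1 / (2 - A)) + 9 / 8 * extremal_quotient A
      + lambda_const * (extremal_quotient A)\<^sup>2"
    using q lambda_const_bounds(1) radius_ratio_le[OF A(2) r(1)] r(3) A
    by (intro add_mono mult_left_mono power_mono) (auto simp: A_def power_le_one)
  also have "\<dots> \<le> 1"
  \<comment> \<open>\<open>ratio\<close> has a pole at 1, but there \<open>1 - A\<^sup>2\<close> and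
    \<open>extremal_quotient A\<close> both vanish.\<close>
  proof (cases "A = 1")
    case True
    then show ?thesis by (simp add: extremal_quotient_def)
  next
    case False
    then have "A < 1" using A by simp
    have "lambda_const * (extremal_quotient A)\<^sup>2 \<le> ratio A * (extremal_quotient A)\<^sup>2"
      by (intro mult_right_mono lambda_const_le_ratio A(1) \<open>A < 1\<close>) simp
    then show ?thesis using extremal_identity[OF A(1) \<open>A < 1\<close>] by simp
  qed
  finally show ?thesis .
qed

section \<open>The extremal functions\<close>

definition disc_aut_coeff :: "real \<Rightarrow> nat \<Rightarrow> complex" where
  "disc_aut_coeff a n = (case n of 0 \<Rightarrow> of_real a | Suc k \<Rightarrow> - of_real ((1 - a\<^sup>2) * a ^ k))"

text \<open>From \<open>(a - z) / (1 - a * z) = a - (1 - a\<^sup>2) * z / (1 - a * z)\<close> and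
  the geometric series.\<close>

lemma power_series_disc_aut:
  assumes a: "0 \<le> a" "a < 1"
  shows "power_series_on_disc (disc_aut_coeff a) (disc_aut a)"
  unfolding power_series_on_disc_def
proof
  fix z :: complex assume "z \<in> ball 0 1"
  then have "cmod (of_real a * z) \<le> a" using a by (simp add: norm_mult mult_left_le)
  then have lt: "cmod (of_real a * z) < 1" using a by linarith
  then have nz: "1 - of_real a * z \<noteq> 0" by auto
  let ?c = "- (1 - (of_real a)\<^sup>2) * z"
  have "(\<lambda>n. ?c * (of_real a * z) ^ n) sums (?c * (1 / (1 - of_real a * z)))"
    by (intro sums_mult geometric_sums lt)
  also have "(\<lambda>n. ?c * (of_real a * z) ^ n) = (\<lambda>n. disc_aut_coeff a (Suc n) * z ^ Suc n)"
    by (rule ext) (simp add: disc_aut_coeff_def power_mult_distrib algebra_simps)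
  finally have "(\<lambda>n. disc_aut_coeff a n * z ^ n) sums
      (?c * (1 / (1 - of_real a * z)) + disc_aut_coeff a 0 * z ^ 0)"
    by (subst (asm) sums_Suc_iff)
  also have "?c * (1 / (1 - of_real a * z)) + disc_aut_coeff a 0 * z ^ 0 = disc_aut a z"
    using nz by (simp add: disc_aut_coeff_def disc_aut_def field_simps power2_eq_square)
  finally show "(\<lambda>n. disc_aut_coeff a n * z ^ n) sums disc_aut a z" .
qed

text \<open>Equality holds in \<open>refined_bohr\<close> for \<open>f\<^sub>a\<close> at every
  \<open>r\<close>, not only at the critical radius.\<close>

lemma bohr_lhs_disc_aut:
  assumes a: "0 \<le> a" "a < 1" and r: "0 < r" "r < 1"
  defines "q \<equiv> (1 - a\<^sup>2)\<^sup>2 * r\<^sup>2 / ((1 - r\<^sup>2) * (1 - a ^ 4 * r\<^sup>2))"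
  shows "bohr_lhs (disc_aut_coeff a) (disc_aut a) r
    = a\<^sup>2 + (1 - a\<^sup>2) * (r / (1 - r)) + 9 / 8 * q + lambda_const * q\<^sup>2"
proof -
  let ?c = "disc_aut_coeff a"
  have a2: "a\<^sup>2 < 1" using a by (simp add: power_less_one_iff)
  have r2: "r\<^sup>2 < 1" using r by (simp add: power_less_one_iff)
  have c0: "cmod (?c 0) = a" using a by (simp add: disc_aut_coeff_def)
  have cS: "cmod (?c (Suc n)) = (1 - a\<^sup>2) * a ^ n" for n
    using a a2 by (simp add: disc_aut_coeff_def norm_mult del: of_real_mult of_real_diff of_real_power)
  have ar: "a * r < 1" "a\<^sup>2 * r\<^sup>2 < 1"
    using mult_strict_mono'[of a 1 r 1] mult_strict_mono'[of "a\<^sup>2" 1 "r\<^sup>2" 1] a r a2 r2 by simp_all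
  have ar0: "0 \<le> a * r" "0 \<le> a\<^sup>2 * r\<^sup>2" using a r by simp_all
  have "(\<lambda>n. (1 - a\<^sup>2) * r * (a * r) ^ n) sums ((1 - a\<^sup>2) * r * (1 / (1 - a * r)))"
    by (intro sums_mult geometric_sums) (use ar ar0 in simp)
  moreover have "cmod (?c (Suc n)) * r ^ Suc n = (1 - a\<^sup>2) * r * (a * r) ^ n" for n
    by (simp add: cS power_mult_distrib)
  ultimately have "(\<lambda>n. cmod (?c (Suc n)) * r ^ Suc n) sums ((1 - a\<^sup>2) * r * (1 / (1 - a * r)))"
    by (simp only:)
  from sums_unique[OF this, symmetric]
  have s1: "(\<Sum>n. cmod (?c (Suc n)) * r ^ Suc n) = (1 - a\<^sup>2) * r / (1 - a * r)"
    by (simp only: times_divide_eq_right mult_1_right)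
  have pw: "r ^ (2 * Suc n) = r\<^sup>2 * (r\<^sup>2) ^ n" for n
    by (simp only: power_mult power_Suc)
  have pw': "(a ^ n)\<^sup>2 = (a\<^sup>2) ^ n" for n
    by (simp only: power_mult[symmetric] mult.commute)
  have sq: "(cmod (?c (Suc n)))\<^sup>2 * r ^ (2 * Suc n) = (1 - a\<^sup>2)\<^sup>2 * r\<^sup>2 * (a\<^sup>2 * r\<^sup>2) ^ n" for n
    by (simp only: cS pw pw' power_mult_distrib) (simp only: mult_ac)
  have "(\<lambda>n. (1 - a\<^sup>2)\<^sup>2 * r\<^sup>2 * (a\<^sup>2 * r\<^sup>2) ^ n) sums ((1 - a\<^sup>2)\<^sup>2 * r\<^sup>2 * (1 / (1 - a\<^sup>2 * r\<^sup>2)))"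
    by (intro sums_mult geometric_sums) (use ar ar0 in simp)
  then have s2: "(\<Sum>n. (cmod (?c (Suc n)))\<^sup>2 * r ^ (2 * Suc n))
      = (1 - a\<^sup>2)\<^sup>2 * r\<^sup>2 / (1 - a\<^sup>2 * r\<^sup>2)"
    unfolding sq by (simp add: sums_iff)
  define B where "B = (1 - a\<^sup>2)\<^sup>2 * r\<^sup>2 / (1 - a\<^sup>2 * r\<^sup>2)\<^sup>2"
  have "(\<lambda>n. pi * ((1 - a\<^sup>2)\<^sup>2 * r\<^sup>2) * (of_nat (Suc n) * (a\<^sup>2 * r\<^sup>2) ^ n))
      sums (pi * ((1 - a\<^sup>2)\<^sup>2 * r\<^sup>2) * (1 / (1 - a\<^sup>2 * r\<^sup>2)\<^sup>2))"
    by (intro sums_mult geometric_deriv_sums) (use ar ar0 in simp)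
  moreover have "pi * ((1 - a\<^sup>2)\<^sup>2 * r\<^sup>2) * (of_nat (Suc n) * (a\<^sup>2 * r\<^sup>2) ^ n)
      = pi * (Suc n * (cmod (?c (Suc n)))\<^sup>2 * r ^ (2 * Suc n))" for n
    using sq[of n] by (simp only: mult.assoc) (simp only: mult_ac)
  ultimately have "(\<lambda>n. pi * (Suc n * (cmod (?c (Suc n)))\<^sup>2 * r ^ (2 * Suc n))) sums (pi * B)"
    by (simp only: B_def times_divide_eq_right mult_1_right mult.assoc)
  with S_area_sums[OF power_series_disc_aut[OF a] r] have S: "S_area (disc_aut a) r = pi * B"
    by (rule sums_unique2)
  have "S_area (disc_aut a) r / (pi - S_area (disc_aut a) r) = (pi * B) / (pi * (1 - B))"
    unfolding S by (simp add: algebra_simps)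
  also have "\<dots> = B / (1 - B)" by simp
  also have "\<dots> = q"
    unfolding q_def B_def by (rule area_quotient(2)) (use a r in auto)
  finally have quot: "S_area (disc_aut a) r / (pi - S_area (disc_aut a) r) = q" .
  have nz: "1 - a * r \<noteq> 0" "1 + a * r \<noteq> 0" "1 - r \<noteq> 0" "1 + a \<noteq> 0"
    using ar ar0 a r by linarith+
  have f2: "1 - a\<^sup>2 * r\<^sup>2 = (1 - a * r) * (1 + a * r)" by algebra
  \<comment> \<open>The numerator \<open>1 + a * r\<close> cancels one factor of
    \<open>1 - a\<^sup>2 * r\<^sup>2\<close>, which makes the two Bohr sums combine.\<close>
  have "1 / (1 + a) + r / (1 - r) = (1 + a * r) / ((1 + a) * (1 - r))"
    using nz by (simp add: field_simps)
  then have "(1 / (1 + a) + r / (1 - r)) * ((1 - a\<^sup>2)\<^sup>2 * r\<^sup>2 / (1 - a\<^sup>2 * r\<^sup>2))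
      = ((1 - a\<^sup>2) * r) * ((1 - a) * r / ((1 - r) * (1 - a * r)))"
    unfolding f2 using nz by (simp add: divide_simps) (simp add: power2_eq_square algebra_simps)
  moreover have "(1 - a\<^sup>2) * r / (1 - a * r) + ((1 - a\<^sup>2) * r) * ((1 - a) * r / ((1 - r) * (1 - a * r)))
      = (1 - a\<^sup>2) * (r / (1 - r))"
    using nz by (simp add: divide_simps) algebra
  ultimately show ?thesis
    unfolding bohr_lhs_def c0 s1 s2 quot by linarith
qed

theorem theorem2p11:
  shows "(\<exists>!t::real. 0 < t \<and> t < 1 \<and> gamma_poly t = 0)
    \<and> \<bar>gamma_root - 0.571317\<bar> < 0.0000005
    \<and> 10.7879 \<le> lambda_const \<and> lambda_const < 10.7880
    \<and> (\<forall>(f :: complex \<Rightarrow> complex) (a :: nat \<Rightarrow> complex) (r :: real).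
         f analytic_on ball 0 1 \<longrightarrow>
         power_series_on_disc a f \<longrightarrow>
         (\<forall>z\<in>ball 0 1. cmod (f z) \<le> 1) \<longrightarrow>
         0 < r \<longrightarrow> r < 1 \<longrightarrow> r \<le> 1 / (3 - cmod (a 0)) \<longrightarrow>
         bohr_lhs a f r \<le> 1)
    \<and> (\<exists>a. power_series_on_disc a (disc_aut gamma_root)
         \<and> bohr_lhs a (disc_aut gamma_root) (1 / (3 - gamma_root)) = 1)"
proof (intro conjI allI impI)
  show "\<exists>!t::real. 0 < t \<and> t < 1 \<and> gamma_poly t = 0" by (rule gamma_root_ex1)
  show "\<bar>gamma_root - 0.571317\<bar> < 0.0000005"
    using gamma_root_bounds by (simp add: abs_less_iff)
  show "10.7879 \<le> lambda_const" "lambda_const < 10.7880" by (fact lambda_const_bounds)+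
next
  fix f a r
  assume "f analytic_on ball 0 1" "power_series_on_disc a f" "\<forall>z\<in>ball 0 1. cmod (f z) \<le> 1"
    "0 < r" "r < 1" "r \<le> 1 / (3 - cmod (a 0))"
  then show "bohr_lhs a f r \<le> 1"
    by (intro bohr_inequality analytic_imp_holomorphic) auto
next
  define r where "r = 1 / (3 - gamma_root)"
  have g: "0 \<le> gamma_root" "gamma_root < 1" using gamma_root by auto
  have r: "0 < r" "r < 1" using g by (auto simp: r_def)
  have rr: "r / (1 - r) = 1 / (2 - gamma_root)" using g by (simp add: r_def field_simps)
  have q: "(1 - gamma_root\<^sup>2)\<^sup>2 * r\<^sup>2 / ((1 - r\<^sup>2) * (1 - gamma_root ^ 4 * r\<^sup>2)) = extremal_quotient gamma_root"
    unfolding r_def by (rule area_quotient_extremal_radius) (use g in auto)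
  \<comment> \<open>The coefficient for which \<open>extremal_identity\<close> holds at \<gamma> is
    \<open>ratio gamma_root\<close>, that is, \<open>lambda_const\<close>.\<close>
  have "bohr_lhs (disc_aut_coeff gamma_root) (disc_aut gamma_root) r = 1"
    unfolding bohr_lhs_disc_aut[OF g r] q rr lambda_const_eq_ratio
    using extremal_identity[OF g] by simp
  then show "\<exists>a. power_series_on_disc a (disc_aut gamma_root)
         \<and> bohr_lhs a (disc_aut gamma_root) (1 / (3 - gamma_root)) = 1"
    using power_series_disc_aut[OF g] unfolding r_def by blast
qed

end
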